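(* Let $k\in\mathbb{N}$, $k\neq 1$, let $G$ be a connected monothetic compact Lie group with generator $\gamma_0$, let $(X,T)$, $X=G^k$, be the Milnes type skew product dynamical system with base group $G$, and let $\Sigma$ be its Ellis group. Then, identifying $\Sigma$ with its image in $E^{k-1}\times G$ under the embedding $\Theta$ (defined in the context), $$\Lambda(\Sigma)=\{(n(\ ),n^2(\ ),\ldots,n^{k-1}(\ ),u)\in\Sigma:\ n\in\mathbb{Z}\text{ and }u\in G\}\subset E^{k-1}\times G .$$ That is, $\Theta(\Lambda(\Sigma))$ is the set of all elements of $\Theta(\Sigma)$ of the form $(n(\ ),n^2(\ ),\ldots,n^{k-1}(\ ),u)$ with $n\in\mathbb{Z}$, $u\in G$.
   Context: A compact monothetic group with generator $\gamma_0$ is a compact Hausdorff topological group $G$ such that the subgroup generated by $\gamma_0\in G$ is dense in $G$ (so $G$ is abelian; written additively here). Milnes type skew product dynamical system with base group $G$: $X=G^k$ and $T:X\to X$ is the homeomorphism $T(x_1,\ldots,x_k)=(y_1,\ldots,y_k)$ with $y_i=\binom{k}{i}\gamma_0+\sum_{j=1}^{i}\binom{k-j}{i-j}x_j$ for $i=1,\ldots,k$. This system is distal. The Ellis group $\Sigma$ of $(X,T)$ is the closure of $\{T^n:n\in\mathbb{Z}\}$ in $X^X$ with the product topology (topology of pointwise convergence on $X$); under composition it is a compact right topological group, i.e. every right translation $\sigma\mapsto\sigma\tau$ is continuous. Its topological centre is $\Lambda(\Sigma)=\{\sigma\in\Sigma:\tau\mapsto\sigma\tau\text{ is continuous on }\Sigma\}$.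 $E=E(G)$ is the compact set of all (not necessarily continuous) endomorphisms of $G$, with the topology of pointwise convergence. For $n\in\mathbb{Z}$, $n(\ )\in E$ denotes the endomorphism $x\mapsto nx$. The map $\Theta:\Sigma\to E^{k-1}\times G$: for $\tau\in\Sigma$ write $\tau=\lim_\alpha T^{m_\alpha}$ for a net $(m_\alpha)$ in $\mathbb{Z}$; passing to a subnet, assume that $\theta_i(t)=\lim_\alpha m_\alpha^i t$ exists for all $t\in G$ and $i=1,\ldots,k-1$, and that $u=\lim_\alpha m_\alpha^k\gamma_0$ exists. Then $\Theta(\tau)=(\theta_1,\ldots,\theta_{k-1},u)$; this is independent of the choices, and $\Theta$ is injective and a homeomorphism onto its image. *)

theory Defs
  imports "HOL-Analysis.Analysis"
begin

section \<open>Smooth maps and Lie groups\<close>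

text \<open>
  Over a finite-dimensional domain a map is \<open>C\<^sup>r\<^sup>+\<^sup>1\<close> on an open set iff it is
  differentiable there and each of its directional derivatives is \<open>C\<^sup>r\<close>.
\<close>

primrec Ck_on :: "nat \<Rightarrow> ('a::euclidean_space \<Rightarrow> 'b::euclidean_space) \<Rightarrow> 'a set \<Rightarrow> bool" where
  "Ck_on 0 f U \<longleftrightarrow> continuous_on U f"
| "Ck_on (Suc r) f U \<longleftrightarrow>
     (\<exists>f'. (\<forall>x\<in>U. (f has_derivative f' x) (at x)) \<and> (\<forall>v. Ck_on r (\<lambda>x. f' x v) U))"

definition smooth_on :: "('a::euclidean_space \<Rightarrow> 'b::euclidean_space) \<Rightarrow> 'a set \<Rightarrow> bool" where
  "smooth_on f U \<longleftrightarrow> (\<forall>r. Ck_on r f U)"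

text \<open>
  A chart is a pair of its domain \<open>W\<close> and its coordinate map \<open>\<phi>\<close> (only the values of \<open>\<phi>\<close>
  on \<open>W\<close> matter); its inverse is \<^term>\<open>inv_into W \<phi>\<close>.
\<close>

definition smooth_atlas :: "('g::topological_space set \<times> ('g \<Rightarrow> 'e::euclidean_space)) set \<Rightarrow> bool" where
  "smooth_atlas A \<longleftrightarrow>
     (\<Union>(W, \<phi>)\<in>A. W) = UNIV \<and>
     (\<forall>(W, \<phi>)\<in>A. open W \<and> open (\<phi> ` W) \<and> homeomorphism W (\<phi> ` W) \<phi> (inv_into W \<phi>)) \<and>
     (\<forall>(W, \<phi>)\<in>A. \<forall>(V, \<psi>)\<in>A. smooth_on (\<lambda>a. \<psi> (inv_into W \<phi> a)) (\<phi> ` (W \<inter> V)))"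

definition smooth_add :: "('g::topological_group_add set \<times> ('g \<Rightarrow> 'e::euclidean_space)) set \<Rightarrow> bool" where
  "smooth_add A \<longleftrightarrow>
     (\<forall>(W, \<phi>)\<in>A. \<forall>(W', \<phi>')\<in>A. \<forall>(V, \<psi>)\<in>A.
        smooth_on (\<lambda>(a, b). \<psi> (inv_into W \<phi> a + inv_into W' \<phi>' b))
          {(\<phi> x, \<phi>' y) | x y. x \<in> W \<and> y \<in> W' \<and> x + y \<in> V})"

definition smooth_uminus :: "('g::topological_group_add set \<times> ('g \<Rightarrow> 'e::euclidean_space)) set \<Rightarrow> bool" where
  "smooth_uminus A \<longleftrightarrow>
     (\<forall>(W, \<phi>)\<in>A. \<forall>(V, \<psi>)\<in>A.
        smooth_on (\<lambda>a. \<psi> (- inv_into W \<phi> a)) {\<phi> x | x. x \<in> W \<and> - x \<in> V})"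

text \<open>
  The topological group \<open>'g\<close> carries the structure of a Lie group of dimension
  \<open>DIM('e)\<close>, or of dimension 0. The zero-dimensional Lie groups are the discrete groups;
  they need a separate clause because the types of class \<^class>\<open>euclidean_space\<close> have positive
  dimension. (Being Hausdorff and second countable is not part of the definition; in the
  application \<open>'g\<close> is a Hausdorff type and compact.)
\<close>

definition lie_group :: "'g::topological_group_add itself \<Rightarrow> 'e::euclidean_space itself \<Rightarrow> bool" where
  "lie_group G V \<longleftrightarrow>
     (\<forall>x::'g. open {x}) \<or>
     (\<exists>A::('g set \<times> ('g \<Rightarrow> 'e)) set. smooth_atlas A \<and> smooth_add A \<and> smooth_uminus A)"

section \<open>Monothetic groups\<close>

definition zmul :: "int \<Rightarrow> 'g::ab_group_add \<Rightarrow> 'g" where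
  "zmul n x = (if 0 \<le> n then \<Sum>i<nat n. x else - (\<Sum>i<nat (- n). x))"

definition compact_monothetic :: "'g::{topological_ab_group_add,t2_space} \<Rightarrow> bool" where
  "compact_monothetic \<gamma> \<longleftrightarrow> compact (UNIV :: 'g set) \<and> closure (range (\<lambda>n. zmul n \<gamma>)) = UNIV"

definition endos :: "('g::ab_group_add \<Rightarrow> 'g) set" where
  "endos = {f. \<forall>x y. f (x + y) = f x + f y}"

section \<open>Ellis groups\<close>

text \<open>
  Self-maps of a space \<open>X\<close> are represented by functions that are \<^const>\<open>undefined\<close> outside
  \<^term>\<open>topspace X\<close>, with \<^const>\<open>compose\<close> as composition.
\<close>

definition self_maps :: "'x topology \<Rightarrow> ('x \<Rightarrow> 'x) topology" where
  "self_maps X = product_topology (\<lambda>_. X) (topspace X)"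

definition int_iterate :: "'x topology \<Rightarrow> ('x \<Rightarrow> 'x) \<Rightarrow> int \<Rightarrow> 'x \<Rightarrow> 'x" where
  "int_iterate X T n =
     restrict (if 0 \<le> n then T ^^ nat n else inv_into (topspace X) T ^^ nat (- n)) (topspace X)"

definition ellis_group :: "'x topology \<Rightarrow> ('x \<Rightarrow> 'x) \<Rightarrow> ('x \<Rightarrow> 'x) set" where
  "ellis_group X T = self_maps X closure_of range (int_iterate X T)"

definition topological_centre :: "'x topology \<Rightarrow> ('x \<Rightarrow> 'x) set \<Rightarrow> ('x \<Rightarrow> 'x) set" where
  "topological_centre X S =
     {\<sigma>\<in>S. continuous_map (subtopology (self_maps X) S) (subtopology (self_maps X) S)
             (\<lambda>\<tau>. compose (topspace X) \<sigma> \<tau>)}"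

section \<open>Milnes type skew products\<close>

definition milnes_space :: "nat \<Rightarrow> (nat \<Rightarrow> 'g::topological_space) topology" where
  "milnes_space k = product_topology (\<lambda>_. euclidean) {1..k}"

definition milnes_map :: "nat \<Rightarrow> 'g::ab_group_add \<Rightarrow> (nat \<Rightarrow> 'g) \<Rightarrow> (nat \<Rightarrow> 'g)" where
  "milnes_map k \<gamma> x =
     (\<lambda>i\<in>{1..k}. zmul (int (k choose i)) \<gamma> +
        (\<Sum>j=1..i. zmul (int ((k - j) choose (i - j))) (x j)))"

definition milnes_ellis :: "nat \<Rightarrow> 'g::topological_ab_group_add \<Rightarrow> ((nat \<Rightarrow> 'g) \<Rightarrow> (nat \<Rightarrow> 'g)) set" where
  "milnes_ellis k \<gamma> = ellis_group (milnes_space k) (milnes_map k \<gamma>)"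

text \<open>
  \<open>milnes_limit k \<gamma> \<tau> (\<theta>, u)\<close>: some net \<open>m\<^sub>\<alpha>\<close> of integers satisfies \<open>T\<^bsup>m\<^sub>\<alpha>\<^esup> \<rightarrow> \<tau>\<close>,
  \<open>m\<^sub>\<alpha>\<^sup>i t \<rightarrow> \<theta>\<^sub>i(t)\<close> for all \<open>t\<close> and \<open>1 \<le> i \<le> k - 1\<close>, and \<open>m\<^sub>\<alpha>\<^sup>k \<gamma> \<rightarrow> u\<close>. A net of integers
  enters only through the proper filter on \<^typ>\<open>int\<close> generated by its tails, and every proper
  filter arises in this way, so nets are replaced by filters. The tuple
  \<open>(\<theta>\<^sub>1, \<dots>, \<theta>\<^sub>k\<^sub>-\<^sub>1)\<close> is a function extensional on \<open>{1..<k}\<close>.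
\<close>

definition milnes_limit ::
  "nat \<Rightarrow> 'g::topological_ab_group_add \<Rightarrow> ((nat \<Rightarrow> 'g) \<Rightarrow> (nat \<Rightarrow> 'g)) \<Rightarrow>
    (nat \<Rightarrow> 'g \<Rightarrow> 'g) \<times> 'g \<Rightarrow> bool" where
  "milnes_limit k \<gamma> \<tau> = (\<lambda>(\<theta>, u).
     \<theta> \<in> extensional {1..<k} \<and>
     (\<exists>F. F \<noteq> bot \<and>
        limitin (self_maps (milnes_space k)) (int_iterate (milnes_space k) (milnes_map k \<gamma>)) \<tau> F \<and>
        (\<forall>i\<in>{1..<k}. \<forall>t. ((\<lambda>m. zmul (m ^ i) t) \<longlongrightarrow> \<theta> i t) F) \<and>
        ((\<lambda>m. zmul (m ^ k) \<gamma>) \<longlongrightarrow> u) F))"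

definition milnes_Theta ::
  "nat \<Rightarrow> 'g::topological_ab_group_add \<Rightarrow> ((nat \<Rightarrow> 'g) \<Rightarrow> (nat \<Rightarrow> 'g)) \<Rightarrow> (nat \<Rightarrow> 'g \<Rightarrow> 'g) \<times> 'g" where
  "milnes_Theta k \<gamma> \<tau> = (THE p. milnes_limit k \<gamma> \<tau> p)"

end

theory Submission
  imports Defs
begin

text \<open>
  Write a point of $X$ together with the generator as a vector $(x_0, x_1, \dots, x_k)$, $x_0 = \gamma$.
  Then $T$ is the unipotent matrix with entries $\binom{k-j}{i-j}$, and $T^m$ has the entries
  $m^{i-j}\binom{k-j}{i-j}$. Passing to limits, an element \<open>\<sigma>\<close> of the Ellis group acts by
  \[ \sigma(x)_i = \sigma(0)_i + \sum_{1 \le j < i} \binom{k-j}{i-j}\, \theta_{i-j}(x_j) + x_i , \]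
  where $\theta_1, \dots, \theta_{k-1}$ are the first coordinates of $\Theta(\sigma)$. Since the
  coefficient of $\theta_i(x_{k-i})$ in the last coordinate is 1, the maps $\theta_i$ and
  $u = \sigma(0)_k$ can be read off from \<open>\<sigma>\<close>; so the limits that define $\Theta$ exist and are unique
  (\<open>milnes_Theta_eq_coords\<close>).

  If $\theta_i = n^i(\ )$ for all $i$, the formula shows that \<open>\<sigma>\<close> is a continuous self-map of $X$, so
  $\tau \mapsto \sigma\tau$ is continuous (\<open>topological_centre_of_integral_coords\<close>).

  Conversely, let \<open>\<sigma>\<close> be in the topological centre. The map $\tau \mapsto \tau(0)_1$ sends the Ellis group
  onto $kG = G$, and it is a quotient map by compactness. Coordinate $i + 1$ of $\sigma(\tau(0))$ is
  continuous in $\tau$; it is the sum of a constant, of $\tau(0)_{i+1}$, of terms with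
  $\theta_1, \dots, \theta_{i-1}$ and of $\binom{k-1}{i}\theta_i(\tau(0)_1)$. By induction on $i$, and because
  multiplication by $\binom{k-1}{i}$ is a quotient map of $G$, every $\theta_i$ is continuous
  (\<open>centre_coords_continuous\<close>).

  It remains to see that a continuous pointwise limit \<open>\<theta>\<^sub>1\<close> of multiplications $m_\alpha(\ )$ on a
  nontrivial $G$ is an integer $c$ on a circle subgroup of $G$: it maps each circle into itself, and a
  continuous endomorphism of a circle is multiplication by an integer. Looking at the points of order $N$
  on the circle gives $m_\alpha \equiv c \pmod N$ eventually, for every $N$. Hence
  $m_\alpha^i t = c^i t$ eventually for every torsion element $t$, that is, $\theta_i = c^i(\ )$ on the
  torsion subgroup, which is dense (\<open>continuous_limit_of_powers_integral\<close>).

  The Lie structure enters only through coordinates near 0 in which the addition of $G$ differs from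
  vector addition by $O(|a|\,|b|)$ (\<open>lie_group_additive_chart\<close>). In such coordinates the $n$-th multiple
  is close to $a \mapsto na$, so by Brouwer's theorem small elements have small $n$-th roots
  (\<open>additive_chart_root\<close>). Divisibility of $G$, density of torsion and the existence of a circle
  subgroup are consequences of this and of compactness.
\<close>

section \<open>Integer multiples\<close>

lemma zmul_0 [simp]: "zmul 0 x = 0"
  by (simp add: zmul_def)

lemma zmul_1 [simp]: "zmul 1 x = x"
  by (simp add: zmul_def)

lemma zmul_plus_1: "zmul (n + 1) x = zmul n x + x"
proof (cases "0 \<le> n")
  case True
  then show ?thesis by (simp add: zmul_def nat_add_distrib)
next
  case False
  then have "nat (- n) = Suc (nat (- (n + 1)))" by simp
  with False show ?thesis by (simp add: zmul_def)
qed

lemma zmul_add: "zmul (m + n) x = zmul m x + zmul n x"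
proof (induction n rule: int_induct[where k = 0])
  case (step1 i)
  have "zmul (m + (i + 1)) x = zmul (m + i) x + x"
    using zmul_plus_1[of "m + i" x] by (simp add: add.assoc)
  with step1 show ?case by (simp add: zmul_plus_1 add.assoc)
next
  case (step2 i)
  have "zmul (m + i) x = zmul (m + (i - 1)) x + x"
    using zmul_plus_1[of "m + (i - 1)" x] by (simp add: algebra_simps)
  moreover have "zmul i x = zmul (i - 1) x + x"
    using zmul_plus_1[of "i - 1" x] by simp
  ultimately show ?case using step2 by (metis add_right_cancel add.assoc)
qed simp

lemma zmul_uminus: "zmul (- n) x = - zmul n x"
  using zmul_add[of n "- n" x] by (simp add: eq_neg_iff_add_eq_0 add.commute)

lemma zmul_diff: "zmul (m - n) x = zmul m x - zmul n x"
  using zmul_add[of m "- n" x] by (simp add: zmul_uminus)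

text \<open>
  Additive maps commute with integer multiples; this is also used for maps out of the reals, where
  \<^const>\<open>zmul\<close> is ordinary multiplication.
\<close>

lemma zmul_additive:
  assumes "\<And>x y. f (x + y) = f x + f y"
  shows "f (zmul n x) = zmul n (f x)"
proof -
  have 0: "f 0 = 0" using assms[of 0 0] by simp
  show ?thesis
  proof (induction n rule: int_induct[where k = 0])
    case (step1 i)
    then show ?case by (simp add: zmul_plus_1 assms)
  next
    case (step2 i)
    have "f (zmul (i - 1) x) + f x = zmul (i - 1) (f x) + f x"
      using step2 zmul_plus_1[of "i - 1" x] zmul_plus_1[of "i - 1" "f x"] assms[of "zmul (i - 1) x" x] by simp
    then show ?case by simp
  qed (simp add: 0)
qed

lemma zmul_add_right: "zmul n (x + y) = zmul n x + zmul n y"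
proof (induction n rule: int_induct[where k = 0])
  case (step1 i)
  then show ?case by (simp add: zmul_add add_ac)
next
  case (step2 i)
  have "zmul (i - 1) (x + y) + (x + y) = (zmul (i - 1) x + zmul (i - 1) y) + (x + y)"
    using step2 zmul_plus_1[of "i - 1" x] zmul_plus_1[of "i - 1" y] zmul_plus_1[of "i - 1" "x + y"]
    by (simp add: add_ac)
  then show ?case by simp
qed simp

lemma zmul_zmul: "zmul m (zmul n x) = zmul (m * n) x"
proof (induction m rule: int_induct[where k = 0])
  case (step1 i)
  then show ?case by (simp add: zmul_add algebra_simps)
next
  case (step2 i)
  then show ?case by (simp add: zmul_diff algebra_simps)
qed simp

lemma zmul_0_right [simp]: "zmul n 0 = 0"
  using zmul_add_right[of n 0 0] by simp

lemma zmul_minus_right: "zmul n (- x) = - zmul n x"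
  using zmul_add_right[of n x "- x"] by (simp add: eq_neg_iff_add_eq_0 add.commute)

lemma zmul_diff_right: "zmul n (x - y) = zmul n x - zmul n y"
  using zmul_add_right[of n x "- y"] by (simp add: zmul_minus_right)

lemma zmul_sum_right: "zmul n (sum f A) = (\<Sum>i\<in>A. zmul n (f i))"
  by (induction A rule: infinite_finite_induct) (simp_all add: zmul_add_right)

lemma zmul_sum_left: "zmul (sum f A) x = (\<Sum>i\<in>A. zmul (f i) x)"
  by (induction A rule: infinite_finite_induct) (simp_all add: zmul_add)

lemma zmul_real: "zmul n (r::real) = of_int n * r"
  by (induction n rule: int_induct[where k = 0]) (simp_all add: zmul_add zmul_diff algebra_simps)

lemma tendsto_zmul [tendsto_intros]:
  fixes f :: "'a \<Rightarrow> 'g::topological_ab_group_add"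
  assumes "(f \<longlongrightarrow> l) F"
  shows "((\<lambda>x. zmul n (f x)) \<longlongrightarrow> zmul n l) F"
proof (induction n rule: int_induct[where k = 0])
  case (step1 i)
  then show ?case using assms by (simp add: zmul_plus_1 tendsto_add)
next
  case (step2 i)
  then show ?case using assms by (simp add: zmul_diff tendsto_diff)
qed simp

lemma continuous_on_zmul [continuous_intros]:
  fixes f :: "'a::topological_space \<Rightarrow> 'g::topological_ab_group_add"
  shows "continuous_on S f \<Longrightarrow> continuous_on S (\<lambda>x. zmul n (f x))"
  unfolding continuous_on_def by (auto intro: tendsto_zmul)

section \<open>Normalised local coordinates\<close>

text \<open>
  The mean value inequality with a bound on partial derivatives. Bounds obtained by compactness are
  available for each fixed direction only, because the second derivatives of a twice continuously
  differentiable map are continuous direction by direction.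
\<close>

lemma differentiable_bound_Basis:
  fixes f :: "'a::euclidean_space \<Rightarrow> 'b::real_normed_vector"
  assumes "convex S" and "\<And>x. x \<in> S \<Longrightarrow> (f has_derivative f' x) (at x)"
    and "\<And>x i. x \<in> S \<Longrightarrow> i \<in> Basis \<Longrightarrow> norm (f' x i) \<le> B"
    and "x \<in> S" "y \<in> S"
  shows "norm (f x - f y) \<le> real DIM('a) * B * norm (x - y)"
proof (rule differentiable_bound[OF assms(1) _ _ assms(4,5)])
  fix z assume z: "z \<in> S"
  then show "(f has_derivative f' z) (at z within S)"
    using assms(2) has_derivative_at_withinI by blast
  have lin: "linear (f' z)" using assms(2)[OF z] has_derivative_linear by blast
  show "onorm (f' z) \<le> real DIM('a) * B"
  proof (rule onorm_le)
    fix v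
    have "norm (f' z v) = norm (\<Sum>i\<in>Basis. (v \<bullet> i) *\<^sub>R f' z i)"
      by (metis (no_types, lifting) euclidean_representation lin linear_scale linear_sum sum.cong)
    also have "\<dots> \<le> (\<Sum>i\<in>(Basis::'a set). norm v * B)"
    proof (rule order_trans[OF norm_sum sum_mono])
      fix i :: 'a assume i: "i \<in> Basis"
      show "norm ((v \<bullet> i) *\<^sub>R f' z i) \<le> norm v * B"
        using Basis_le_norm[OF i, of v] assms(3)[OF z i] by (simp add: mult_mono)
    qed
    finally show "norm (f' z v) \<le> real DIM('a) * B * norm v" by (simp add: mult_ac)
  qed
qed

text \<open>
  The mixed second difference is the increment in the first variable of the increment in the second;
  applying the mean value inequality in each variable bounds it by a bound on the mixed second
  partial derivatives, which are continuous and hence bounded on a compact neighbourhood.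
\<close>

lemma C2_mixed_difference:
  fixes F :: "'a::euclidean_space \<times> 'a \<Rightarrow> 'a"
  assumes C2: "Ck_on 2 F U" and "open U" and pp: "(p, p) \<in> U"
  obtains r C where "r > 0" "C > 0" "cball p r \<times> cball p r \<subseteq> U"
    "\<And>a b. a \<in> cball p r \<Longrightarrow> b \<in> cball p r \<Longrightarrow>
       norm (F (a, b) - F (a, p) - F (p, b) + F (p, p)) \<le> C * norm (a - p) * norm (b - p)"
proof -
  obtain F' where F': "\<And>z. z \<in> U \<Longrightarrow> (F has_derivative F' z) (at z)"
    and C1: "\<And>v. Ck_on 1 (\<lambda>z. F' z v) U"
    using C2 by (auto simp: numeral_2_eq_2)
  have "\<forall>v. \<exists>F2. (\<forall>z\<in>U. ((\<lambda>z. F' z v) has_derivative F2 z) (at z)) \<and> (\<forall>w. continuous_on U (\<lambda>z. F2 z w))"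
    using C1 by simp
  then obtain F2 where F2: "\<And>v z. z \<in> U \<Longrightarrow> ((\<lambda>z. F' z v) has_derivative F2 v z) (at z)"
    and F2c: "\<And>v w. continuous_on U (\<lambda>z. F2 v z w)"
    by metis
  obtain A B where AB: "open A" "open B" "(p, p) \<in> A \<times> B" "A \<times> B \<subseteq> U"
    using open_prod_elim[OF \<open>open U\<close> pp] by metis
  then obtain r where r: "r > 0" "cball p r \<subseteq> A \<inter> B"
    using open_contains_cball[of "A \<inter> B"] by (metis open_Int IntI mem_Sigma_iff)
  define K where "K = cball p r"
  have KU: "K \<times> K \<subseteq> U" using r AB unfolding K_def by blast
  have pK: "p \<in> K" using r by (simp add: K_def)
  have convK: "convex K" by (simp add: K_def)
  have compK: "compact (K \<times> K)" by (simp add: K_def compact_Times)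
  have "\<forall>v w. \<exists>M. \<forall>z\<in>K \<times> K. norm (F2 v z w) \<le> M"
  proof (intro allI)
    fix v w
    have "bounded ((\<lambda>z. F2 v z w) ` (K \<times> K))"
      by (intro compact_imp_bounded compact_continuous_image compK continuous_on_subset[OF F2c KU])
    then show "\<exists>M. \<forall>z\<in>K \<times> K. norm (F2 v z w) \<le> M" by (auto simp: bounded_iff)
  qed
  then obtain M where M: "\<And>v w z. z \<in> K \<times> K \<Longrightarrow> norm (F2 v z w) \<le> M v w"
    by metis
  define D where "D = real DIM('a)"
  define MM where "MM = (\<Sum>v\<in>(Basis::'a set). \<Sum>w\<in>(Basis::'a set). \<bar>M (v, 0) (0, w)\<bar>)"
  have MM: "norm (F2 (v, 0) z (0, w)) \<le> MM" if "v \<in> Basis" "w \<in> Basis" "z \<in> K \<times> K" for v w :: 'a and z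
  proof -
    have "\<bar>M (v, 0) (0, w)\<bar> \<le> (\<Sum>w\<in>(Basis::'a set). \<bar>M (v, 0) (0, w)\<bar>)"
      by (rule member_le_sum) (use that in auto)
    also have "\<dots> \<le> MM" unfolding MM_def
      by (rule member_le_sum[where f = "\<lambda>v. \<Sum>w\<in>(Basis::'a set). \<bar>M (v, 0) (0, w)\<bar>"]) (use that in \<open>auto intro: sum_nonneg\<close>)
    finally show ?thesis using M[OF that(3), of "(v, 0)" "(0, w)"] by linarith
  qed
  have D1: "norm (F' (a, b) (v, 0) - F' (a, p) (v, 0)) \<le> D * MM * norm (b - p)"
    if "a \<in> K" "b \<in> K" "v \<in> Basis" for a b v
    unfolding D_def
  proof (rule differentiable_bound_Basis[OF convK])
    fix y assume y: "y \<in> K"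
    have "((\<lambda>z. F' z (v, 0)) has_derivative F2 (v, 0) (a, y)) (at (a, y))"
      using F2 KU that y by blast
    moreover have "(Pair a has_derivative (\<lambda>h. (0, h))) (at y)"
      by (auto intro!: derivative_eq_intros)
    ultimately show "((\<lambda>b. F' (a, b) (v, 0)) has_derivative (\<lambda>h. F2 (v, 0) (a, y) (0, h))) (at y)"
      using has_derivative_compose[of "Pair a" _ y UNIV "\<lambda>z. F' z (v, 0)"] by simp
  next
    fix y i :: 'a assume "y \<in> K" "i \<in> Basis"
    then show "norm (F2 (v, 0) (a, y) (0, i)) \<le> MM" using MM that by simp
  qed (use that pK in auto)
  define C where "C = D * (D * MM) + 1"
  have MM0: "MM \<ge> 0" unfolding MM_def by (intro sum_nonneg) simp
  have D0: "D \<ge> 0" by (simp add: D_def)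
  have "norm (F (a, b) - F (a, p) - F (p, b) + F (p, p)) \<le> C * norm (a - p) * norm (b - p)"
    if ab: "a \<in> K" "b \<in> K" for a b
  proof -
    have "norm ((F (a, b) - F (a, p)) - (F (p, b) - F (p, p))) \<le> D * (D * MM * norm (b - p)) * norm (a - p)"
      unfolding D_def
    proof (rule differentiable_bound_Basis[OF convK])
      fix x assume x: "x \<in> K"
      have *: "((\<lambda>x. F (x, y)) has_derivative (\<lambda>h. F' (x, y) (h, 0))) (at x)" if "y \<in> K" for y
      proof -
        have 1: "((\<lambda>x. (x, y)) has_derivative (\<lambda>h. (h, 0))) (at x)"
          by (auto intro!: derivative_eq_intros)
        have 2: "(F has_derivative F' (x, y)) (at (x, y))" using F' KU x that by blast
        show ?thesis by (rule has_derivative_compose[OF 1 2])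
      qed
      show "((\<lambda>x. F (x, b) - F (x, p)) has_derivative (\<lambda>h. F' (x, b) (h, 0) - F' (x, p) (h, 0))) (at x)"
        by (intro has_derivative_diff * ab pK)
    next
      fix x i :: 'a assume "x \<in> K" "i \<in> Basis"
      then show "norm (F' (x, b) (i, 0) - F' (x, p) (i, 0)) \<le> real DIM('a) * MM * norm (b - p)"
        using D1 ab by (simp add: D_def)
    qed (use ab pK in auto)
    also have "\<dots> \<le> C * norm (a - p) * norm (b - p)"
      by (simp add: C_def algebra_simps)
    finally show ?thesis by (simp add: algebra_simps)
  qed
  moreover have "C > 0" using MM0 D0 by (simp add: C_def add_nonneg_pos)
  ultimately show ?thesis using that r KU unfolding K_def by blast
qed

text \<open>
  Coordinates around 0, given by their inverse \<open>\<psi>\<close>, in which the group law is $a + b$ up to an error of at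
  most $|a|\,|b|/4$. Rescaling the coordinates makes this constant as small as desired. The domain of
  radius 4 leaves room for the sums of vectors of norm at most 1, whose coordinates have norm at most
  $2 + 1/4$.
\<close>

definition additive_chart :: "('e::euclidean_space \<Rightarrow> 'g::topological_ab_group_add) \<Rightarrow> bool" where
  "additive_chart \<psi> \<longleftrightarrow>
     continuous_on (cball 0 4) \<psi> \<and> inj_on \<psi> (cball 0 4) \<and> \<psi> 0 = 0 \<and>
     (\<forall>s\<le>4. open (\<psi> ` ball 0 s)) \<and>
     (\<forall>a b. norm a \<le> 1 \<longrightarrow> norm b \<le> 1 \<longrightarrow>
        (\<exists>c. norm (c - a - b) \<le> norm a * norm b / 4 \<and> \<psi> a + \<psi> b = \<psi> c))"

text \<open>
  Let $F$ be the group law in a chart that maps 0 to $p$. Since $F(a,p) = a$ and $F(p,b) = b$, the mixed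
  second difference of $F$ at $(a, b)$ is the deviation of $F(a,b)$ from vector addition with origin $p$.
\<close>

lemma lie_group_additive_chart:
  assumes "lie_group TYPE('g::topological_ab_group_add) TYPE('e::euclidean_space)"
    and "\<not> (\<forall>x::'g::topological_ab_group_add. open {x})"
  obtains \<psi> :: "'e::euclidean_space \<Rightarrow> 'g::topological_ab_group_add" where "additive_chart \<psi>"
proof -
  obtain A :: "('g set \<times> ('g \<Rightarrow> 'e)) set" where A: "smooth_atlas A" "smooth_add A"
    using assms unfolding lie_group_def by blast
  have "(0::'g) \<in> (\<Union>(W, \<phi>)\<in>A. W)" using A(1) unfolding smooth_atlas_def by simp
  then obtain W \<phi> where W: "(W, \<phi>) \<in> A" "0 \<in> W" by auto
  define Z where "Z = \<phi> ` W"
  define \<zeta> where "\<zeta> = inv_into W \<phi>"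
  have op: "open W" "open Z" and hom: "homeomorphism W Z \<phi> \<zeta>"
    using A(1) W unfolding smooth_atlas_def Z_def \<zeta>_def by auto
  have \<zeta>\<phi>: "\<zeta> (\<phi> x) = x" if "x \<in> W" for x using hom that by (simp add: homeomorphism_def)
  have \<phi>\<zeta>: "\<phi> (\<zeta> a) = a" "\<zeta> a \<in> W" if "a \<in> Z" for a using hom that by (auto simp: homeomorphism_def)
  have \<zeta>c: "continuous_on Z \<zeta>" using hom by (simp add: homeomorphism_def)
  define F where "F = (\<lambda>(a, b). \<phi> (\<zeta> a + \<zeta> b))"
  define U where "U = {(\<phi> x, \<phi> y) | x y. x \<in> W \<and> y \<in> W \<and> x + y \<in> W}"
  have U: "(a, b) \<in> U \<longleftrightarrow> a \<in> Z \<and> b \<in> Z \<and> \<zeta> a + \<zeta> b \<in> W" for a b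
    unfolding U_def Z_def using \<zeta>\<phi> by force
  have "U = (Z \<times> Z) \<inter> (\<lambda>z. \<zeta> (fst z) + \<zeta> (snd z)) -` W" using U by auto
  moreover have "continuous_on (Z \<times> Z) (\<lambda>z. \<zeta> (fst z) + \<zeta> (snd z))"
    by (intro continuous_on_add continuous_on_compose2[OF \<zeta>c] continuous_intros) auto
  ultimately have opU: "open U"
    using op by (metis continuous_on_open_vimage open_Times Int_commute)
  have "smooth_on F U"
    using A(2) W unfolding smooth_add_def F_def U_def \<zeta>_def by blast
  then have C2: "Ck_on 2 F U" by (simp add: smooth_on_def)
  define p where "p = \<phi> 0"
  have p: "p \<in> Z" "\<zeta> p = 0" using W \<zeta>\<phi> by (auto simp: p_def Z_def)
  then have pp: "(p, p) \<in> U" using U W by simp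
  obtain r C where rC: "r > 0" "C > 0" "cball p r \<times> cball p r \<subseteq> U"
    and est: "\<And>a b. a \<in> cball p r \<Longrightarrow> b \<in> cball p r \<Longrightarrow>
       norm (F (a, b) - F (a, p) - F (p, b) + F (p, p)) \<le> C * norm (a - p) * norm (b - p)"
    using C2_mixed_difference[OF C2 opU pp] by metis
  \<comment> \<open>scaling by \<open>s\<close> keeps the ball of radius 4 inside the domain and turns the constant \<open>C\<close> into \<open>C * s \<le> 1 / 4\<close>\<close>
  define s where "s = min (r / 4) (1 / (4 * C))"
  have s: "s > 0" "4 * s \<le> r" "C * s \<le> 1 / 4"
  proof -
    show "s > 0" using rC by (simp add: s_def)
    show "4 * s \<le> r" by (simp add: s_def)
    have "s \<le> 1 / (4 * C)" by (simp add: s_def)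
    then show "C * s \<le> 1 / 4" using rC by (simp add: field_simps)
  qed
  define \<psi> where "\<psi> a = \<zeta> (p + s *\<^sub>R a)" for a
  have inK: "p + s *\<^sub>R a \<in> cball p r" if "norm a \<le> 4" for a
  proof -
    have "s * norm a \<le> s * 4" using that s by (intro mult_left_mono) auto
    then have "s * norm a \<le> r" using s by linarith
    then show ?thesis using s by (simp add: dist_norm)
  qed
  have KZ: "cball p r \<subseteq> Z" using rC(3) U rC(1) by auto
  have "continuous_on (cball 0 4) \<psi>"
    unfolding \<psi>_def
    by (intro continuous_on_compose2[OF \<zeta>c] continuous_intros) (use inK KZ in auto)
  moreover have "inj_on \<psi> (cball 0 4)"
  proof (rule inj_onI)
    fix a b :: 'e assume ab: "a \<in> cball 0 4" "b \<in> cball 0 4" "\<psi> a = \<psi> b"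
    then have "p + s *\<^sub>R a = p + s *\<^sub>R b"
      using inK[of a] inK[of b] KZ \<phi>\<zeta> unfolding \<psi>_def by (metis mem_cball_0 subsetD)
    then show "a = b" using s by simp
  qed
  moreover have "\<psi> 0 = 0" by (simp add: \<psi>_def p)
  moreover have "open (\<psi> ` ball 0 t)" if t: "t \<le> 4" for t
  proof -
    let ?B = "(\<lambda>a. p + s *\<^sub>R a) ` ball 0 t"
    have "open ((\<lambda>a. p + a) ` ((\<lambda>a. s *\<^sub>R a) ` ball 0 t))"
      using s by (intro open_translation open_scaling) auto
    then have oB: "open ?B" by (simp add: image_image)
    have BZ: "?B \<subseteq> Z" using inK KZ t by force
    have "\<zeta> ` ?B = W \<inter> \<phi> -` ?B"
    proof
      show "\<zeta> ` ?B \<subseteq> W \<inter> \<phi> -` ?B" using \<phi>\<zeta> BZ by (smt (verit) IntI image_subset_iff subsetD vimageI)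
      show "W \<inter> \<phi> -` ?B \<subseteq> \<zeta> ` ?B" using \<zeta>\<phi> by (metis (no_types, lifting) Int_iff image_eqI subsetI vimage_eq)
    qed
    moreover have "open (W \<inter> \<phi> -` ?B)"
      using hom op oB by (metis continuous_on_open_vimage homeomorphism_cont1 Int_commute)
    ultimately show ?thesis by (simp add: \<psi>_def image_image)
  qed
  moreover have "\<exists>c. norm (c - a - b) \<le> norm a * norm b / 4 \<and> \<psi> a + \<psi> b = \<psi> c"
    if ab: "norm a \<le> 1" "norm b \<le> 1" for a b
  proof -
    let ?a = "p + s *\<^sub>R a" and ?b = "p + s *\<^sub>R b"
    define c where "c = (F (?a, ?b) - p) /\<^sub>R s"
    have K: "?a \<in> cball p r" "?b \<in> cball p r" using inK ab by auto
    have F0: "F (x, p) = x" "F (p, x) = x" if "x \<in> Z" for x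
      using that p \<phi>\<zeta> by (auto simp: F_def)
    have pc: "p + s *\<^sub>R c = F (?a, ?b)" using s by (simp add: c_def)
    have "F (?a, ?b) - F (?a, p) - F (p, ?b) + F (p, p) = s *\<^sub>R (c - a - b)"
      using K KZ F0 p pc[symmetric] by (simp add: algebra_simps subset_iff)
    then have "s * norm (c - a - b) \<le> C * (s * norm a) * (s * norm b)"
      using est[OF K] s by simp
    then have "s * norm (c - a - b) \<le> s * (C * s * (norm a * norm b))" by (simp add: mult_ac)
    then have "norm (c - a - b) \<le> C * s * (norm a * norm b)" using s by simp
    also have "\<dots> \<le> 1 / 4 * (norm a * norm b)" using s by (intro mult_right_mono) auto
    finally have n: "norm (c - a - b) \<le> norm a * norm b / 4" by simp
    have "(?a, ?b) \<in> U" using K rC by blast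
    then have "\<zeta> (F (?a, ?b)) = \<zeta> ?a + \<zeta> ?b" using U \<zeta>\<phi> by (simp add: F_def)
    then have "\<psi> a + \<psi> b = \<psi> c" by (simp add: \<psi>_def pc)
    with n show ?thesis by blast
  qed
  ultimately have "additive_chart \<psi>" unfolding additive_chart_def by blast
  then show ?thesis using that by blast
qed

section \<open>Roots, divisibility and torsion\<close>

text \<open>
  The errors of the successive additions of $a$ grow like the sum of $j|a|^2$ over $j < n$, so the total is
  quadratic in $n|a|$.
\<close>

lemma additive_chart_zmul:
  assumes \<psi>: "additive_chart \<psi>" and n: "real n * norm a \<le> 1 / 2"
  shows "\<exists>b. zmul (int n) (\<psi> a) = \<psi> b \<and> norm (b - real n *\<^sub>R a) \<le> (real n * norm a)\<^sup>2 / 2"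
  using n
proof (induction n)
  case 0
  show ?case using \<psi> by (auto simp: additive_chart_def intro: exI[of _ 0])
next
  case (Suc n)
  have le: "real n * norm a \<le> 1 / 2" "norm a \<le> 1"
  proof -
    have "real (Suc n) * norm a = real n * norm a + norm a" by (simp add: algebra_simps)
    moreover have "real n * norm a \<ge> 0" "norm a \<ge> 0" by auto
    ultimately show "real n * norm a \<le> 1 / 2" "norm a \<le> 1" using Suc.prems by linarith+
  qed
  obtain b where b: "zmul (int n) (\<psi> a) = \<psi> b" "norm (b - real n *\<^sub>R a) \<le> (real n * norm a)\<^sup>2 / 2"
    using Suc.IH[OF le(1)] by blast
  have sq: "(real n * norm a)\<^sup>2 \<le> real n * norm a * 1"
    unfolding power2_eq_square using le by (intro mult_left_mono) auto
  have bn: "norm b \<le> 2 * (real n * norm a)"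
  proof -
    have "norm b \<le> real n * norm a + norm (b - real n *\<^sub>R a)"
      using norm_triangle_sub[of b "real n *\<^sub>R a"] by simp
    then show ?thesis using b(2) sq mult_nonneg_nonneg[OF of_nat_0_le_iff[of n] norm_ge_zero[of a]] by linarith
  qed
  then have "norm b \<le> 1" using le by linarith
  then obtain c where c: "norm (c - b - a) \<le> norm b * norm a / 4" "\<psi> b + \<psi> a = \<psi> c"
    using \<psi> le(2) unfolding additive_chart_def by blast
  have "norm (c - real (Suc n) *\<^sub>R a) = norm ((c - b - a) + (b - real n *\<^sub>R a))"
    by (simp add: algebra_simps)
  also have "\<dots> \<le> norm b * norm a / 4 + (real n * norm a)\<^sup>2 / 2"
    using norm_triangle_ineq[of "c - b - a" "b - real n *\<^sub>R a"] b(2) c(1) by linarith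
  also have "\<dots> \<le> (2 * (real n * norm a)) * norm a / 4 + (real n * norm a)\<^sup>2 / 2"
    using mult_right_mono[OF bn norm_ge_zero[of a]] by (simp add: algebra_simps)
  also have "\<dots> \<le> (real (Suc n) * norm a)\<^sup>2 / 2"
    by (simp add: power2_eq_square algebra_simps)
  finally have "norm (c - real (Suc n) *\<^sub>R a) \<le> (real (Suc n) * norm a)\<^sup>2 / 2" .
  moreover have "zmul (int (Suc n)) (\<psi> a) = \<psi> c"
    using zmul_plus_1[of "int n" "\<psi> a"] b c by (simp add: add.commute)
  ultimately show ?case by blast
qed

text \<open>
  In coordinates, taking the $n$-th multiple is a map $P$ with $P(a) = na + O((n|a|)^2)$. A solution of
  $P(a) = c$ is a fixed point of $a \mapsto a - (P(a) - c)/n$, and this continuous map preserves the ball of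
  radius $2|c|/n$. The bound on the root is what makes roots of small elements small, uniformly in $n$.
\<close>

lemma additive_chart_root:
  fixes \<psi> :: "'e::euclidean_space \<Rightarrow> 'g::{topological_ab_group_add,t2_space}"
  assumes \<psi>: "additive_chart \<psi>" and c: "norm c \<le> 1 / 4" and n: "n \<ge> 1"
  shows "\<exists>a. norm a \<le> 2 * norm c / real n \<and> zmul (int n) (\<psi> a) = \<psi> c"
proof -
  have cont: "continuous_on (cball 0 4) \<psi>" and inj: "inj_on \<psi> (cball 0 4)"
    using \<psi> by (auto simp: additive_chart_def)
  define R where "R = 2 * norm c / real n"
  define P where "P a = the_inv_into (cball 0 4) \<psi> (zmul (int n) (\<psi> a))" for a
  have nR: "real n * norm a \<le> 2 * norm c" if "a \<in> cball 0 R" for a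
    using that n by (simp add: R_def field_simps)
  have P: "zmul (int n) (\<psi> a) = \<psi> (P a) \<and> norm (P a - real n *\<^sub>R a) \<le> (real n * norm a)\<^sup>2 / 2
      \<and> P a \<in> cball 0 4" if a: "a \<in> cball 0 R" for a
  proof -
    have na: "real n * norm a \<le> 1 / 2" using nR[OF a] c by simp
    obtain b where b: "zmul (int n) (\<psi> a) = \<psi> b" "norm (b - real n *\<^sub>R a) \<le> (real n * norm a)\<^sup>2 / 2"
      using additive_chart_zmul[OF \<psi> na] by blast
    have "(real n * norm a)\<^sup>2 \<le> (1 / 2)\<^sup>2" using na by (intro power_mono) auto
    then have "norm b \<le> 4"
      using b(2) na norm_triangle_sub[of b "real n *\<^sub>R a"] by (simp add: power2_eq_square)
    then have "P a = b" unfolding P_def b(1) by (intro the_inv_into_f_f inj) simp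
    with b \<open>norm b \<le> 4\<close> show ?thesis by simp
  qed
  have "R \<le> 4" using c n by (simp add: R_def field_simps)
  then have c1: "continuous_on (cball 0 R) (\<lambda>a. zmul (int n) (\<psi> a))"
    by (intro continuous_intros continuous_on_subset[OF cont]) auto
  have c2: "continuous_on (\<psi> ` cball 0 4) (the_inv_into (cball 0 4) \<psi>)"
    by (intro continuous_on_inv_into cont inj compact_cball)
  have "continuous_on (cball 0 R) P"
    unfolding P_def
  proof (rule continuous_on_compose2[OF c2 c1])
    show "(\<lambda>a. zmul (int n) (\<psi> a)) ` cball 0 R \<subseteq> \<psi> ` cball 0 4" using P by blast
  qed
  then have cont_h: "continuous_on (cball 0 R) (\<lambda>a. a - (P a - c) /\<^sub>R real n)"
    by (intro continuous_intros)
  have "a - (P a - c) /\<^sub>R real n \<in> cball 0 R" if a: "a \<in> cball 0 R" for a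
  proof -
    have "a - (P a - c) /\<^sub>R real n = (c - (P a - real n *\<^sub>R a)) /\<^sub>R real n"
      using n by (simp add: algebra_simps)
    then have "norm (a - (P a - c) /\<^sub>R real n) = norm (c - (P a - real n *\<^sub>R a)) / real n"
      by (simp add: divide_inverse mult.commute)
    also have "\<dots> \<le> (norm c + (real n * norm a)\<^sup>2 / 2) / real n"
      using P[OF a] norm_triangle_ineq4[of c "P a - real n *\<^sub>R a"] by (intro divide_right_mono) auto
    also have "\<dots> \<le> (norm c + norm c) / real n"
    proof (intro divide_right_mono add_left_mono)
      have "(real n * norm a)\<^sup>2 \<le> (2 * norm c)\<^sup>2" using nR[OF a] by (intro power_mono) auto
      also have "\<dots> = 2 * norm c * (2 * norm c)" by (simp add: power2_eq_square)
      also have "\<dots> \<le> 2 * norm c * 1" using c by (intro mult_left_mono) auto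
      finally show "(real n * norm a)\<^sup>2 / 2 \<le> norm c" by simp
    qed simp
    finally show ?thesis by (simp add: R_def)
  qed
  moreover have "cball (0::'e) R \<noteq> {}" using n by (simp add: R_def not_less)
  ultimately obtain a where a: "a \<in> cball 0 R" "a - (P a - c) /\<^sub>R real n = a"
    using brouwer[OF compact_cball convex_cball _ cont_h] by blast
  then have "P a = c" using n by simp
  then show ?thesis using P[OF a(1)] a(1) by (auto simp: R_def)
qed

lemma additive_chart_small:
  assumes \<psi>: "additive_chart \<psi>" and U: "open U" "0 \<in> U"
  obtains s where "s > 0" "s \<le> 4" "\<psi> ` ball 0 s \<subseteq> U"
proof -
  have "continuous_on (ball 0 4) \<psi>" "\<psi> 0 = 0"
    using \<psi> by (auto simp: additive_chart_def intro: continuous_on_subset)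
  then have "open (\<psi> -` U \<inter> ball 0 4)" "0 \<in> \<psi> -` U \<inter> ball 0 4"
    using U by (simp_all add: continuous_on_open_vimage)
  then obtain s where s: "s > 0" "ball 0 s \<subseteq> \<psi> -` U \<inter> ball 0 4"
    using open_contains_ball by blast
  then have "\<psi> ` ball 0 (min s 4) \<subseteq> U" by auto
  then show ?thesis using that[of "min s 4"] s(1) by simp
qed

lemma open_translation_group:
  fixes S :: "'g::topological_ab_group_add set"
  assumes "open S"
  shows "open ((+) x ` S)"
proof -
  have "(+) x ` S = (\<lambda>y. y - x) -` S" by (force simp: image_iff)
  moreover have "continuous_on UNIV (\<lambda>y. y - x)" by (intro continuous_intros)
  ultimately show ?thesis using assms open_vimage by metis
qed

text \<open>
  The subgroup $nG$ contains a neighbourhood of 0 because small elements have $n$-th roots; an open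
  subgroup of a connected group is the whole group.
\<close>

lemma connected_group_divisible:
  fixes \<psi> :: "'e::euclidean_space \<Rightarrow> 'g::{topological_ab_group_add,t2_space}"
  assumes \<psi>: "additive_chart \<psi>" and conn: "connected (UNIV :: 'g set)" and n: "n \<ge> 1"
  shows "surj (zmul (int n) :: 'g \<Rightarrow> 'g)"
proof -
  let ?H = "range (zmul (int n) :: 'g \<Rightarrow> 'g)"
  define V where "V = \<psi> ` ball 0 (1 / 4)"
  have V: "open V" "0 \<in> V" using \<psi> unfolding V_def additive_chart_def by force+
  have VH: "V \<subseteq> ?H"
  proof
    fix v assume "v \<in> V"
    then obtain c where c: "v = \<psi> c" "norm c \<le> 1 / 4" by (auto simp: V_def)
    show "v \<in> ?H" using additive_chart_root[OF \<psi> c(2) n] c(1) by (metis rangeI)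
  qed
  have H_add: "x + y \<in> ?H" if "x \<in> ?H" "y \<in> ?H" for x y
    using that by (auto simp flip: zmul_add_right)
  have H_diff: "x - y \<in> ?H" if "x \<in> ?H" "y \<in> ?H" for x y
    using that by (auto simp flip: zmul_diff_right)
  have nbhd: "\<exists>T. open T \<and> x \<in> T \<and> T \<subseteq> S"
    if "(+) x ` V \<subseteq> S" for x and S :: "'g set"
  proof (intro exI conjI)
    show "x \<in> (+) x ` V" using V(2) image_eqI[of x "(+) x" 0 V] by simp
  qed (use that open_translation_group[OF V(1)] in auto)
  have "open ?H"
  proof (subst open_subopen, intro ballI nbhd)
    fix x assume "x \<in> ?H"
    then show "(+) x ` V \<subseteq> ?H" using VH H_add by (intro image_subsetI) (meson subsetD)
  qed
  moreover have "open (- ?H)"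
  proof (subst open_subopen, intro ballI nbhd)
    fix x assume x: "x \<in> - ?H"
    show "(+) x ` V \<subseteq> - ?H"
    proof (intro image_subsetI ComplI)
      fix v assume v: "v \<in> V" "x + v \<in> ?H"
      then have "x + v - v \<in> ?H" using VH H_diff by blast
      with x show False by simp
    qed
  qed
  ultimately have "?H = {} \<or> ?H = UNIV"
    using conn unfolding connected_clopen closed_def[symmetric] by auto
  then show ?thesis by blast
qed

text \<open>
  Pigeonhole principle: finitely many small translates cover the group, so two multiples of $x$ lie in the
  same translate and their difference is small.
\<close>

lemma compact_group_recurrence:
  fixes V :: "'g::topological_ab_group_add set"
  assumes comp: "compact (UNIV :: 'g set)" and V: "open V" "0 \<in> V"
  shows "\<exists>n\<ge>1. zmul (int n) x \<in> V"
proof -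
  have "continuous_on UNIV (\<lambda>z::'g \<times> 'g. fst z - snd z)" by (intro continuous_intros)
  then have "open ((\<lambda>z::'g \<times> 'g. fst z - snd z) -` V)" using V open_vimage by blast
  moreover have "(0, 0) \<in> (\<lambda>z::'g \<times> 'g. fst z - snd z) -` V" using V by simp
  ultimately obtain A B where AB: "open A" "open B" "(0, 0) \<in> A \<times> B"
      "A \<times> B \<subseteq> (\<lambda>z::'g \<times> 'g. fst z - snd z) -` V"
    by (rule open_prod_elim)
  define W where "W = A \<inter> B"
  have W: "open W" "0 \<in> W" "\<And>a b. a \<in> W \<Longrightarrow> b \<in> W \<Longrightarrow> a - b \<in> V"
    using AB by (auto simp: W_def)
  have "\<And>y. y \<in> (+) y ` W" using W(2) by force
  then have "UNIV \<subseteq> (\<Union>y\<in>UNIV. (+) y ` W)" by blast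
  then obtain D where D: "finite D" "UNIV \<subseteq> (\<Union>y\<in>D. (+) y ` W)"
    using compactE_image[OF comp, of UNIV "\<lambda>y. (+) y ` W"] open_translation_group[OF W(1)] by metis
  then have "\<forall>j::nat. \<exists>y\<in>D. zmul (int j) x \<in> (+) y ` W" by blast
  then obtain g where g: "\<And>j::nat. g j \<in> D \<and> zmul (int j) x \<in> (+) (g j) ` W" by metis
  have "\<not> inj g"
    using D(1) g by (metis finite_subset finite_imageD infinite_UNIV_nat image_subsetI)
  then obtain i j where ij: "g i = g j" "i < j" by (metis injI linorder_neqE_nat)
  obtain a b where ab: "a \<in> W" "b \<in> W" "zmul (int j) x = g j + a" "zmul (int i) x = g j + b"
    using g[of i] g[of j] ij by auto
  have "zmul (int (j - i)) x = a - b" using ab ij by (simp add: of_nat_diff zmul_diff)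
  then have "zmul (int (j - i)) x \<in> V" using W ab by simp
  then show ?thesis using ij by (intro exI[of _ "j - i"]) simp
qed

text \<open>
  Some multiple $nx$ is small by recurrence and therefore has a small $n$-th root $w$. Then $x - w$ is close
  to $x$ and $n(x - w) = 0$.
\<close>

lemma torsion_dense:
  fixes \<psi> :: "'e::euclidean_space \<Rightarrow> 'g::{topological_ab_group_add,t2_space}"
  assumes \<psi>: "additive_chart \<psi>" and comp: "compact (UNIV :: 'g set)"
    and U: "open U" "(x :: 'g) \<in> U"
  shows "\<exists>t\<in>U. \<exists>n\<ge>1. zmul (int n) t = 0"
proof -
  have "continuous_on UNIV (\<lambda>w. x - w)"
    by (intro continuous_intros)
  then have "open ((\<lambda>w. x - w) -` U)" "0 \<in> (\<lambda>w. x - w) -` U" using U open_vimage by auto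
  then obtain s where s: "s > 0" "s \<le> 4" "\<psi> ` ball 0 s \<subseteq> (\<lambda>w. x - w) -` U"
    using additive_chart_small[OF \<psi>] by metis
  define r where "r = s / 16"
  have "open (\<psi> ` ball 0 r)" "0 \<in> \<psi> ` ball 0 r"
    using \<psi> s unfolding additive_chart_def r_def by force+
  then obtain n where n: "n \<ge> 1" "zmul (int n) x \<in> \<psi> ` ball 0 r"
    using compact_group_recurrence[OF comp] by blast
  then obtain c where c: "zmul (int n) x = \<psi> c" "norm c < r" by auto
  have "norm c \<le> 1 / 4" using c s by (simp add: r_def)
  then obtain a where a: "norm a \<le> 2 * norm c / real n" "zmul (int n) (\<psi> a) = \<psi> c"
    using additive_chart_root[OF \<psi> _ n(1)] by blast
  have "2 * norm c / real n \<le> 2 * norm c" using n by (simp add: divide_le_eq mult_le_cancel_left1)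
  then have "norm a < s" using a c s by (simp add: r_def)
  then have "\<psi> a \<in> \<psi> ` ball 0 s" by simp
  then have "x - \<psi> a \<in> U" using s by blast
  moreover have "zmul (int n) (x - \<psi> a) = 0" using a c by (simp add: zmul_diff_right)
  ultimately show ?thesis using n by blast
qed

section \<open>A circle subgroup\<close>

text \<open>
  Tychonoff's theorem: every family of functions into a compact space converges pointwise along a finer proper
  filter.
\<close>

lemma pointwise_cluster_point:
  fixes E :: "'i \<Rightarrow> 'a \<Rightarrow> 'g::topological_space"
  assumes comp: "compact (UNIV :: 'g set)" and F: "F \<noteq> bot"
  obtains H e where "H \<noteq> bot" "H \<le> F" "\<And>s. ((\<lambda>i. E i s) \<longlongrightarrow> e s) H"
proof -
  have "compact (UNIV :: ('a \<Rightarrow> 'g) set)"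
    using comp compact_space_product_topology[of "\<lambda>_::'a. euclidean :: 'g topology" UNIV]
    by (simp add: compact_space_def euclidean_product_topology)
  moreover have "filtermap E F \<noteq> bot" using F by (simp add: filtermap_bot_iff)
  ultimately obtain e where e: "inf (nhds e) (filtermap E F) \<noteq> bot"
    unfolding compact_filter by (metis UNIV_I always_eventually)
  define H where "H = inf (filtercomap E (nhds e)) F"
  have "H \<noteq> bot"
  proof
    assume "H = bot"
    then have "eventually (\<lambda>_. False) H" by simp
    then obtain P Q where P: "eventually P (filtercomap E (nhds e))" and Q: "eventually Q F"
      and PQ: "\<And>i. P i \<Longrightarrow> Q i \<Longrightarrow> False"
      unfolding H_def eventually_inf by blast
    obtain P' where P': "eventually P' (nhds e)" "\<And>i. P' (E i) \<Longrightarrow> P i"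
      using P unfolding eventually_filtercomap by blast
    have "eventually (\<lambda>f. \<not> P' f) (filtermap E F)"
      unfolding eventually_filtermap using Q by eventually_elim (use P' PQ in blast)
    then have "eventually (\<lambda>_. False) (inf (nhds e) (filtermap E F))"
      unfolding eventually_inf using P'(1) by blast
    then show False using e by (simp add: eventually_False)
  qed
  moreover have "H \<le> F" by (simp add: H_def)
  moreover have "((\<lambda>i. E i s) \<longlongrightarrow> e s) H" for s
  proof -
    have "filterlim E (nhds e) H"
      by (simp add: H_def filterlim_iff_le_filtercomap)
    moreover have "((\<lambda>f. f s) \<longlongrightarrow> e s) (nhds e)"
      using continuous_on_product_coordinates[of s]
      by (metis UNIV_I continuous_on_def tendsto_at_iff_tendsto_nhds)
    ultimately show ?thesis by (rule filterlim_compose[rotated])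
  qed
  ultimately show ?thesis using that by blast
qed

lemma additive_continuous:
  fixes f :: "'a::topological_ab_group_add \<Rightarrow> 'b::topological_ab_group_add"
  assumes add: "\<And>x y. f (x + y) = f x + f y" and lim: "(f \<longlongrightarrow> 0) (nhds 0)"
  shows "continuous_on UNIV f"
proof -
  have "(f \<longlongrightarrow> f x) (nhds x)" for x
  proof -
    have "((\<lambda>y. y - x) \<longlongrightarrow> x - x) (nhds x)" by (intro tendsto_intros filterlim_ident)
    then have "((\<lambda>y. f (y - x)) \<longlongrightarrow> 0) (nhds x)"
      using filterlim_compose[OF lim] by simp
    then have "((\<lambda>y. f (y - x) + f x) \<longlongrightarrow> 0 + f x) (nhds x)" by (intro tendsto_intros)
    moreover have "f (y - x) + f x = f y" for y using add[of "y - x" x] by simp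
    ultimately show ?thesis by simp
  qed
  then show ?thesis
    unfolding continuous_on_def by (meson UNIV_I at_within_le_nhds tendsto_mono)
qed

text \<open>
  Choose an $n$-th root $w_n$ of \<open>\<psi> c\<close> with coordinates of norm at most $2|c|/n$. The step functions
  $s \mapsto \lfloor ns \rfloor w_n$ are additive up to one term $w_n$, so each pointwise cluster point is
  additive. For $0 < s \le 1$ the value at $s$ stays in a shell whose radii are proportional to $s$. The outer radius
  gives continuity of the limit, and the inner one keeps its kernel discrete.
\<close>

lemma one_parameter_subgroup:
  fixes \<psi> :: "'e::euclidean_space \<Rightarrow> 'g::{topological_ab_group_add,t2_space}"
  assumes \<psi>: "additive_chart \<psi>" and comp: "compact (UNIV :: 'g set)"
    and c: "norm c \<le> 1 / 4" "c \<noteq> 0"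
  obtains e :: "real \<Rightarrow> 'g" where "\<And>s t. e (s + t) = e s + e t" "e 1 = \<psi> c"
    "\<And>s. 0 < s \<Longrightarrow> s \<le> 1 \<Longrightarrow> \<exists>b. 3 / 10 * norm c * s \<le> norm b \<and> norm b \<le> 5 / 2 * norm c * s \<and> e s = \<psi> b"
proof -
  have inj: "inj_on \<psi> (cball 0 4)" and cont: "continuous_on (cball 0 4) \<psi>" and \<psi>0: "\<psi> 0 = 0"
    using \<psi> by (auto simp: additive_chart_def)
  have "\<forall>n. n \<ge> 1 \<longrightarrow> (\<exists>a. norm a \<le> 2 * norm c / real n \<and> zmul (int n) (\<psi> a) = \<psi> c)"
    using additive_chart_root[OF \<psi> c(1)] by blast
  then obtain a where a: "\<And>n. n \<ge> 1 \<Longrightarrow> norm (a n) \<le> 2 * norm c / real n"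
      "\<And>n. n \<ge> 1 \<Longrightarrow> zmul (int n) (\<psi> (a n)) = \<psi> c"
    by metis
  define E where "E n s = zmul \<lfloor>real n * s\<rfloor> (\<psi> (a n))" for n and s :: real
  obtain H e where H: "H \<noteq> bot" "H \<le> sequentially" and e: "\<And>s. ((\<lambda>n. E n s) \<longlongrightarrow> e s) H"
    using pointwise_cluster_point[OF comp sequentially_bot, of E] by blast
  have H_ge: "eventually (\<lambda>n. n \<ge> m) H" for m
    using H(2) eventually_ge_at_top filter_leD by blast
  have "e (s + t) = e s + e t" for s t
  proof -
    have "((\<lambda>n. E n (s + t) - E n s - E n t) \<longlongrightarrow> 0) H"
    proof (rule topological_tendstoI)
      fix U :: "'g set" assume U: "open U" "0 \<in> U"
      obtain r where r: "r > 0" "r \<le> 4" "\<psi> ` ball 0 r \<subseteq> U"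
        using additive_chart_small[OF \<psi> U] by blast
      obtain m where m: "2 * norm c / r < real m" using reals_Archimedean2 by blast
      show "eventually (\<lambda>n. E n (s + t) - E n s - E n t \<in> U) H"
        using H_ge[of "max m 1"]
      proof eventually_elim
        fix n assume n: "max m 1 \<le> n"
        have "2 * norm c / r < real n" using m n by linarith
        then have "2 * norm c / real n < r" using r n by (simp add: field_simps)
        then have "norm (a n) < r" using a(1)[of n] n by simp
        then have aU: "\<psi> (a n) \<in> U" using r by auto
        define \<delta> where "\<delta> = \<lfloor>real n * (s + t)\<rfloor> - \<lfloor>real n * s\<rfloor> - \<lfloor>real n * t\<rfloor>"
        have "\<delta> = 0 \<or> \<delta> = 1" unfolding \<delta>_def distrib_left by linarith
        moreover have "E n (s + t) - E n s - E n t = zmul \<delta> (\<psi> (a n))"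
          by (simp add: E_def \<delta>_def zmul_diff)
        ultimately show "E n (s + t) - E n s - E n t \<in> U" using aU U by auto
      qed
    qed
    moreover have "((\<lambda>n. E n (s + t) - E n s - E n t) \<longlongrightarrow> e (s + t) - e s - e t) H"
      by (intro tendsto_intros e)
    ultimately have "e (s + t) - e s - e t = 0" using tendsto_unique[OF H(1)] by blast
    then show ?thesis by (simp add: algebra_simps)
  qed
  moreover have "e 1 = \<psi> c"
  proof -
    have "eventually (\<lambda>n. E n 1 = \<psi> c) H"
      using H_ge[of 1] by eventually_elim (simp add: E_def a(2))
    then have "((\<lambda>n. E n 1) \<longlongrightarrow> \<psi> c) H" by (rule tendsto_eventually)
    then show ?thesis using tendsto_unique[OF H(1) e] by blast
  qed
  moreover have "\<exists>b. 3 / 10 * norm c * s \<le> norm b \<and> norm b \<le> 5 / 2 * norm c * s \<and> e s = \<psi> b"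
    if s: "0 < s" "s \<le> 1" for s
  proof -
    \<comment> \<open>\<open>5 / 2\<close> is \<open>2\<close>, from the bound on the root, times \<open>5 / 4\<close>, from near-linearity; \<open>3 / 10\<close> is
      \<open>3 / 4\<close>, from near-linearity, times \<open>1 / 2\<close>, from the floor, times \<open>4 / 5\<close>, from the root\<close>
    define S where "S = cball 0 (5 / 2 * norm c * s) \<inter> {b::'e. 3 / 10 * norm c * s \<le> norm b}"
    have cs: "norm c * s \<le> 1 / 4 * 1" using c s by (intro mult_mono) auto
    have S4: "S \<subseteq> cball 0 4" using cs by (auto simp: S_def)
    have "compact S" unfolding S_def
      by (intro compact_Int_closed compact_cball closed_Collect_le continuous_intros)
    then have clS: "closed (\<psi> ` S)"
      using compact_imp_closed compact_continuous_image continuous_on_subset[OF cont S4] by blast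
    obtain m where m: "2 / s < real m" using reals_Archimedean2 by blast
    \<comment> \<open>the shell is compact, so its image is closed and contains the limit of the values that lie in it\<close>
    have ev: "eventually (\<lambda>n. E n s \<in> \<psi> ` S) H"
      using H_ge[of "max m 1"]
    proof eventually_elim
      fix n assume n: "max m 1 \<le> n"
      define j where "j = nat \<lfloor>real n * s\<rfloor>"
      define A where "A = norm (a n)"
      \<comment> \<open>\<open>n * s > 2\<close> makes the floor at least half of \<open>n * s\<close>\<close>
      have ns: "2 < real n * s"
      proof -
        have "2 / s < real n" using m n by linarith
        then show ?thesis using s by (simp add: field_simps)
      qed
      have fl: "\<lfloor>real n * s\<rfloor> = int j" using ns by (simp add: j_def)
      have j: "real n * s / 2 \<le> real j" "real j \<le> real n * s"
        using ns fl by linarith+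
      have nA: "real n * A \<le> 2 * norm c" using a(1)[of n] n by (simp add: A_def field_simps)
      have jA: "real j * A \<le> s * (real n * A)"
        using mult_right_mono[OF j(2), of A] by (simp add: A_def mult_ac)
      have jA': "real j * A \<ge> s * (real n * A) / 2"
        using mult_right_mono[OF j(1), of A] by (simp add: A_def mult_ac)
      have "s * (real n * A) \<le> s * (2 * norm c)" using nA s by (intro mult_left_mono) auto
      then have jA2: "real j * A \<le> 2 * (norm c * s)" using jA by (simp add: mult_ac)
      \<comment> \<open>the multiples of the root up to the \<open>n\<close>-th deviate from linear ones by at most a quarter\<close>
      have near: "\<exists>b. zmul (int i) (\<psi> (a n)) = \<psi> b \<and> norm (b - real i *\<^sub>R a n) \<le> real i * A / 4"
        if "real i * A \<le> 1 / 2" for i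
      proof -
        have "(real i * A)\<^sup>2 \<le> real i * A * (1 / 2)"
          unfolding power2_eq_square using that by (intro mult_left_mono) (auto simp: A_def)
        then show ?thesis using additive_chart_zmul[OF \<psi>, of i "a n"] that by (fastforce simp: A_def)
      qed
      have nle: "real n * A \<le> 1 / 2" "real j * A \<le> 1 / 2" using nA c jA2 cs by linarith+
      obtain b' where b': "zmul (int n) (\<psi> (a n)) = \<psi> b'" "norm (b' - real n *\<^sub>R a n) \<le> real n * A / 4"
        using near[OF nle(1)] by blast
      have nb': "norm b' \<le> 5 / 4 * (real n * A)"
        using b'(2) norm_triangle_sub[of b' "real n *\<^sub>R a n"] by (simp add: A_def)
      \<comment> \<open>comparing the \<open>n\<close>-th multiple with \<open>c\<close> bounds the root from below\<close>
      have "b' = c"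
      proof (rule inj_onD[OF inj])
        show "\<psi> b' = \<psi> c" using b' a(2)[of n] n by simp
        show "b' \<in> cball 0 4" "c \<in> cball 0 4" using nb' nle c by auto
      qed
      then have "4 / 5 * norm c \<le> real n * A" using nb' by simp
      then have "s * (4 / 5 * norm c) \<le> s * (real n * A)" using s by (intro mult_left_mono) auto
      then have low: "2 / 5 * (norm c * s) \<le> real j * A" using jA' by (simp add: mult_ac)
      obtain b where b: "zmul (int j) (\<psi> (a n)) = \<psi> b" "norm (b - real j *\<^sub>R a n) \<le> real j * A / 4"
        using near[OF nle(2)] by blast
      have "norm b \<le> 5 / 4 * (real j * A)" "3 / 4 * (real j * A) \<le> norm b"
        using b(2) norm_triangle_sub[of b "real j *\<^sub>R a n"] norm_triangle_sub[of "real j *\<^sub>R a n" b]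
        by (simp_all add: A_def norm_minus_commute)
      then have "b \<in> S" using low jA2 by (simp add: S_def)
      then show "E n s \<in> \<psi> ` S" using b(1) by (simp add: E_def fl)
    qed
    have "e s \<in> \<psi> ` S" using Lim_in_closed_set[OF clS ev H(1) e] .
    then show ?thesis by (auto simp: S_def)
  qed
  ultimately show ?thesis using that by blast
qed

text \<open>
  A continuous homomorphism on the reals with kernel \<open>\<int>\<close>: an embedding of the circle $\mathbb{R}/\mathbb{Z}$ into
  the group.
\<close>

definition circle_subgroup :: "(real \<Rightarrow> 'g::topological_ab_group_add) \<Rightarrow> bool" where
  "circle_subgroup e \<longleftrightarrow> (\<forall>s t. e (s + t) = e s + e t) \<and> continuous_on UNIV e \<and> (\<forall>s. e s = 0 \<longleftrightarrow> s \<in> \<int>)"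

text \<open>
  A one-parameter subgroup through a torsion element has a nonzero kernel. The kernel does not meet
  $(0, 1]$, so it has a least positive element $p$, and rescaling by $p$ turns the kernel into \<open>\<int>\<close>.
\<close>

lemma circle_subgroup_exists:
  fixes \<psi> :: "'e::euclidean_space \<Rightarrow> 'g::{topological_ab_group_add,t2_space}"
  assumes \<psi>: "additive_chart \<psi>" and comp: "compact (UNIV :: 'g set)"
  obtains e :: "real \<Rightarrow> 'g" where "circle_subgroup e"
proof -
  have inj: "inj_on \<psi> (cball 0 4)" and \<psi>0: "\<psi> 0 = 0" using \<psi> by (auto simp: additive_chart_def)
  have nz: "\<psi> b \<noteq> 0" if "b \<noteq> 0" "norm b \<le> 4" for b
    using inj_onD[OF inj, of b 0] that \<psi>0 by auto
  obtain i :: 'e where i: "i \<in> Basis" using nonempty_Basis by blast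
  define U where "U = \<psi> ` ball 0 (1 / 4) - {0}"
  have U: "open U" using \<psi> by (simp add: U_def additive_chart_def open_Diff)
  have "(1 / 8) *\<^sub>R i \<in> ball 0 (1 / 4)" "(1 / 8) *\<^sub>R i \<noteq> 0" using i by auto
  then have "\<psi> ((1 / 8) *\<^sub>R i) \<in> U" using nz i by (auto simp: U_def)
  then obtain t n where t: "t \<in> U" "n \<ge> 1" "zmul (int n) t = 0"
    using torsion_dense[OF \<psi> comp U] by blast
  then obtain c where c: "t = \<psi> c" "norm c \<le> 1 / 4" by (auto simp: U_def)
  have c0: "c \<noteq> 0" using t(1) c \<psi>0 by (auto simp: U_def)
  note c = c c0
  obtain e where add: "\<And>s t. e (s + t) = e s + e t" and e1: "e 1 = \<psi> c" and
    shell: "\<And>s. 0 < s \<Longrightarrow> s \<le> 1 \<Longrightarrow> \<exists>b. 3 / 10 * norm c * s \<le> norm b \<and> norm b \<le> 5 / 2 * norm c * s \<and> e s = \<psi> b"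
    using one_parameter_subgroup[OF \<psi> comp c(2,3)] by blast
  have e0: "e 0 = 0" using add[of 0 0] by simp
  have em: "e (- s) = - e s" for s using add[of s "- s"] e0 by (simp add: eq_neg_iff_add_eq_0 add.commute)
  have "(e \<longlongrightarrow> 0) (nhds 0)"
  proof (rule topological_tendstoI)
    fix U :: "'g set" assume U: "open U" "0 \<in> U"
    have "continuous_on UNIV (uminus :: 'g \<Rightarrow> 'g)" by (intro continuous_intros)
    then have "open (U \<inter> uminus -` U)" "0 \<in> U \<inter> uminus -` U" using U by (auto intro: open_vimage)
    then obtain r where r: "r > 0" "r \<le> 4" "\<psi> ` ball 0 r \<subseteq> U \<inter> uminus -` U"
      using additive_chart_small[OF \<psi>] by metis
    define \<delta> where "\<delta> = min 1 (r / (5 * norm c))"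
    have \<delta>: "\<delta> > 0" "\<delta> \<le> 1" "5 * norm c * \<delta> \<le> r"
    proof -
      show "\<delta> > 0" "\<delta> \<le> 1" using r c by (auto simp: \<delta>_def)
      have "\<delta> \<le> r / (5 * norm c)" by (simp add: \<delta>_def)
      then show "5 * norm c * \<delta> \<le> r" using c by (simp add: field_simps)
    qed
    have pos: "e s \<in> U \<inter> uminus -` U" if s: "0 \<le> s" "s < \<delta>" for s
    proof (cases "s = 0")
      case False
      then obtain b where b: "norm b \<le> 5 / 2 * norm c * s" "e s = \<psi> b"
        using shell[of s] s \<delta> by auto
      have "norm c * s \<le> norm c * \<delta>" using s by (intro mult_left_mono) auto
      then have "norm b < r" using b \<delta> r(1) by linarith
      then have "e s \<in> \<psi> ` ball 0 r" using b by simp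
      then show ?thesis using r by blast
    qed (use U e0 in simp)
    have "e s \<in> U" if "\<bar>s\<bar> < \<delta>" for s
      using pos[of s] pos[of "- s"] em[of s] that by (cases "0 \<le> s") auto
    then show "eventually (\<lambda>s. e s \<in> U) (nhds 0)"
      using \<delta>(1) by (auto simp: eventually_nhds_metric dist_norm)
  qed
  then have cont: "continuous_on UNIV e" by (rule additive_continuous[OF add])
  have ez: "e (of_int m * s) = zmul m (e s)" for m s
    using zmul_additive[of e m s] add by (simp add: zmul_real)
  \<comment> \<open>the kernel has no element in \<open>(0, 1)\<close>, so cutting it off at 1 loses nothing and makes it compact\<close>
  define K where "K = {1..real n} \<inter> e -` {0}"
  have "closed (e -` {0})" using cont by (intro closed_vimage) auto
  then have "compact K" unfolding K_def by (intro compact_Int_closed) auto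
  moreover have "real n \<in> K" using t ez[of "int n" 1] e1 c by (simp add: K_def)
  ultimately obtain p where p: "p \<in> K" "\<And>r. r \<in> K \<Longrightarrow> p \<le> r"
    using compact_attains_inf[of K] by blast
  have p1: "p \<ge> 1" "p \<le> real n" "e p = 0" using p by (auto simp: K_def)
  have nzp: "e r \<noteq> 0" if r: "0 < r" "r < p" for r
  proof (cases "r \<le> 1")
    case True
    then obtain b where b: "3 / 10 * norm c * r \<le> norm b" "norm b \<le> 5 / 2 * norm c * r" "e r = \<psi> b"
      using shell r by blast
    have "norm c * r \<le> 1 / 4 * 1" "0 < norm c * r" using c r True by (intro mult_mono mult_pos_pos; simp)+
    then have "norm b \<le> 4" "b \<noteq> 0" using b by auto
    then show ?thesis using nz b by simp
  next
    case False
    then show ?thesis using p(2)[of r] r p1 by (auto simp: K_def)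
  qed
  define e' where "e' s = e (s * p)" for s
  have "e' s = 0 \<longleftrightarrow> s \<in> \<int>" for s
  proof
    assume "s \<in> \<int>"
    then show "e' s = 0" using ez p1 by (auto simp: e'_def elim!: Ints_cases)
  next
    assume s: "e' s = 0"
    have "e (s * p) = e (of_int \<lfloor>s\<rfloor> * p) + e (frac s * p)"
      by (simp add: add[symmetric] distrib_right[symmetric] frac_def)
    then have "e (frac s * p) = 0" using s ez p1 by (simp add: e'_def)
    moreover have "0 \<le> frac s * p" "frac s * p < p"
      using p1 by (auto simp: frac_ge_0 frac_lt_1)
    ultimately have "frac s * p = 0" using nzp[of "frac s * p"] by linarith
    then show "s \<in> \<int>" using p1 by simp
  qed
  moreover have "e' (s + t) = e' s + e' t" for s t by (simp add: e'_def distrib_right add)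
  moreover have "continuous_on UNIV e'"
    unfolding e'_def by (intro continuous_on_compose2[OF cont] continuous_intros) auto
  ultimately have "circle_subgroup e'" by (simp add: circle_subgroup_def)
  then show ?thesis using that by blast
qed

text \<open>
  The map $f$ descends to an endomorphism of the circle. The arc over $[1/4, 3/4]$ is compact and misses 0,
  so for small $s$ the value $f(s)$ is $e(g(s))$ with $|g(s)| < 1/4$. This lift $g$ is additive, because its
  additivity defect is an integer of absolute value less than 1, and hence linear along the fractions
  $j/(Mn)$. The slope is an integer because $f(1) = 0$.
\<close>

lemma circle_endomorphism:
  fixes e f :: "real \<Rightarrow> 'g::{topological_ab_group_add,t2_space}"
  assumes e: "circle_subgroup e"
    and f: "\<And>s t. f (s + t) = f s + f t" "continuous_on UNIV f" "range f \<subseteq> range e" "f 1 = 0"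
  obtains c :: int where "\<And>n::nat. n \<ge> 1 \<Longrightarrow> f (1 / real n) = zmul c (e (1 / real n))"
proof -
  have add: "\<And>s t. e (s + t) = e s + e t" and cont: "continuous_on UNIV e"
    and ker: "\<And>s. e s = 0 \<longleftrightarrow> s \<in> \<int>"
    using e by (auto simp: circle_subgroup_def)
  have ediff: "e (s - t) = e s - e t" for s t using add[of "s - t" t] by simp
  have ez: "e (of_int m * s) = zmul m (e s)" for m s
    using zmul_additive[of e m s] add by (simp add: zmul_real)
  have fz: "f (of_int m * s) = zmul m (f s)" for m s
    using zmul_additive[of f m s] f(1) by (simp add: zmul_real)
  have f0: "f 0 = 0" using f(1)[of 0 0] by simp
  define U where "U = - (e ` {1 / 4..3 / 4})"
  have "compact (e ` {1 / 4..3 / 4})"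
    by (intro compact_continuous_image continuous_on_subset[OF cont]) auto
  then have oU: "open U" unfolding U_def by (simp add: compact_imp_closed open_Compl)
  have "0 \<in> U"
  proof -
    have "e s \<noteq> 0" if "s \<in> {1 / 4..3 / 4}" for s
    proof
      assume "e s = 0"
      then obtain i :: int where "s = of_int i" using ker Ints_cases by metis
      with that have "0 < real_of_int i" "real_of_int i < 1" by auto
      then show False by simp
    qed
    then show ?thesis unfolding U_def by force
  qed
  then obtain \<delta> where \<delta>: "\<delta> > 0" "\<And>s. \<bar>s\<bar> < \<delta> \<Longrightarrow> f s \<in> U"
  proof -
    have "open (f -` U)" "0 \<in> f -` U" using f(2) oU f0 \<open>0 \<in> U\<close> by (auto intro: open_vimage)
    then obtain \<delta> where "\<delta> > 0" "ball 0 \<delta> \<subseteq> f -` U" using open_contains_ball by blast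
    then show ?thesis using that by (auto simp: subset_iff)
  qed
  have "\<exists>r. \<bar>r\<bar> < 1 / 4 \<and> f s = e r" if s: "\<bar>s\<bar> < \<delta>" for s
  proof -
    obtain r0 where r0: "f s = e r0" using f(3) by blast
    have "e (frac r0) = e r0" using ediff[of r0 "of_int \<lfloor>r0\<rfloor>"] ker[of "of_int \<lfloor>r0\<rfloor>"] by (simp add: frac_def)
    then have fr: "f s = e (frac r0)" using r0 by simp
    then have "frac r0 \<notin> {1 / 4..3 / 4}" using \<delta>(2)[OF s] by (auto simp: U_def)
    then consider "frac r0 < 1 / 4" | "frac r0 > 3 / 4" by fastforce
    then show ?thesis
    proof cases
      case 1
      then show ?thesis using fr frac_ge_0[of r0] by (intro exI[of _ "frac r0"]) simp
    next
      case 2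
      have "e (frac r0 - 1) = e (frac r0)" using ediff[of "frac r0" 1] ker[of 1] by simp
      then show ?thesis using fr 2 frac_lt_1[of r0] by (intro exI[of _ "frac r0 - 1"]) simp
    qed
  qed
  then obtain g where g: "\<And>s. \<bar>s\<bar> < \<delta> \<Longrightarrow> \<bar>g s\<bar> < 1 / 4 \<and> f s = e (g s)" by metis
  have g_add: "g (s + t) = g s + g t" if "\<bar>s\<bar> < \<delta>" "\<bar>t\<bar> < \<delta>" "\<bar>s + t\<bar> < \<delta>" for s t
  proof -
    have "e (g (s + t) - g s - g t) = 0" using that g f(1)[of s t] by (simp add: ediff)
    then obtain i :: int where i: "g (s + t) - g s - g t = of_int i" using ker Ints_cases by metis
    moreover have "\<bar>g (s + t) - g s - g t\<bar> < 1" using g[OF that(1)] g[OF that(2)] g[OF that(3)] by linarith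
    ultimately have "i = 0" by linarith
    with i show ?thesis by simp
  qed
  obtain M :: nat where M: "1 / \<delta> < real M" using reals_Archimedean2 by blast
  then have Mpos: "M \<ge> 1" using \<delta>(1) by (metis One_nat_def Suc_leI divide_pos_pos less_trans of_nat_0_less_iff zero_less_one)
  have M\<delta>: "1 / real M < \<delta>" using M \<delta>(1) Mpos by (simp add: field_simps)
  define a where "a = g (1 / real M)"
  have key: "real n * g (1 / (real M * real n)) = a" if n: "n \<ge> 1" for n :: nat
  proof -
    let ?s = "1 / (real M * real n)"
    have small: "\<bar>real j * ?s\<bar> < \<delta>" if "j \<le> n" for j
    proof -
      have "real j * ?s \<le> real n * ?s" using that by (intro mult_right_mono) auto
      also have "\<dots> = 1 / real M" using n by simp
      finally show ?thesis using M\<delta> by simp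
    qed
    have "g (real j * ?s) = real j * g ?s" if "j \<le> n" for j
      using that
    proof (induction j)
      case 0
      have "g (0 + 0) = g 0 + g 0" using \<delta>(1) by (intro g_add) auto
      then show ?case by simp
    next
      case (Suc j)
      have eq: "real (Suc j) * ?s = real j * ?s + ?s" by (simp only: of_nat_Suc distrib_right add.commute mult_1_left)
      have "g (real j * ?s + ?s) = g (real j * ?s) + g ?s"
      proof (rule g_add)
        show "\<bar>real j * ?s\<bar> < \<delta>" using small[of j] Suc.prems by simp
        show "\<bar>?s\<bar> < \<delta>" using small[of 1] n by simp
        show "\<bar>real j * ?s + ?s\<bar> < \<delta>" using small[OF Suc.prems] by (simp only: eq)
      qed
      also have "\<dots> = real (Suc j) * g ?s" using Suc by (simp add: algebra_simps)
      finally show ?case by (simp only: eq)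
    qed
    from this[of n] show ?thesis using n by (simp add: a_def)
  qed
  have fn: "f (1 / real n) = e (real M * a / real n)" if n: "n \<ge> 1" for n :: nat
  proof -
    let ?s = "1 / (real M * real n)"
    have "?s \<le> 1 / real M" using n Mpos by (simp add: field_simps)
    then have s: "\<bar>?s\<bar> < \<delta>" using M\<delta> by simp
    have "f (1 / real n) = f (of_int (int M) * ?s)" using Mpos by simp
    also have "\<dots> = e (of_int (int M) * g ?s)" using fz ez g[OF s] by metis
    also have "of_int (int M) * g ?s = real M * a / real n"
      using key[OF n] n by (simp add: field_simps)
    finally show ?thesis .
  qed
  have "e (real M * a) = 0" using fn[of 1] f(4) by simp
  then obtain c :: int where c: "real M * a = of_int c" using ker Ints_cases by metis
  have "f (1 / real n) = zmul c (e (1 / real n))" if "n \<ge> 1" for n :: nat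
    using fn[OF that] c ez[of c "1 / real n"] by simp
  then show ?thesis using that by blast
qed

section \<open>Pointwise limits of integer multiplications\<close>

lemma eventually_eq_finite_range:
  fixes f :: "'a \<Rightarrow> 'b::t1_space"
  assumes lim: "(f \<longlongrightarrow> l) F" and A: "finite A" "\<And>x. f x \<in> A"
  shows "eventually (\<lambda>x. f x = l) F"
proof -
  have "open (- (A - {l}))" using A by (intro open_Compl finite_imp_closed) auto
  from topological_tendstoD[OF lim this]
  have "eventually (\<lambda>x. f x \<in> - (A - {l})) F" by simp
  then show ?thesis by eventually_elim (use A in auto)
qed

text \<open>
  Continuity of \<open>\<theta>\<^sub>1\<close> on one circle forces the net $m$ to converge to an integer $c$ modulo every $n$, which
  determines all \<open>\<theta>\<^sub>i\<close> on torsion elements; continuity of \<open>\<theta>\<^sub>i\<close> and density of torsion do the rest.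
\<close>

lemma continuous_limit_of_powers_integral:
  fixes \<theta> :: "nat \<Rightarrow> 'g::{topological_ab_group_add,t2_space} \<Rightarrow> 'g"
    and \<psi> :: "'e::euclidean_space \<Rightarrow> 'g"
  assumes \<psi>: "additive_chart \<psi>" and comp: "compact (UNIV :: 'g set)" and F: "F \<noteq> bot"
    and I: "1 \<in> I"
    and lim: "\<And>i t. i \<in> I \<Longrightarrow> ((\<lambda>m::int. zmul (m ^ i) t) \<longlongrightarrow> \<theta> i t) F"
    and cont: "\<And>i. i \<in> I \<Longrightarrow> continuous_on UNIV (\<theta> i)"
  obtains c :: int where "\<And>i. i \<in> I \<Longrightarrow> \<theta> i = zmul (c ^ i)"
proof -
  have lim1: "((\<lambda>m::int. zmul m t) \<longlongrightarrow> \<theta> 1 t) F" for t using lim[OF I, of t] by simp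
  have add: "\<theta> 1 (s + t) = \<theta> 1 s + \<theta> 1 t" for s t
  proof -
    have "((\<lambda>m::int. zmul m (s + t)) \<longlongrightarrow> \<theta> 1 s + \<theta> 1 t) F"
      unfolding zmul_add_right by (intro tendsto_add lim1)
    then show ?thesis using tendsto_unique[OF F lim1] by blast
  qed
  obtain e :: "real \<Rightarrow> 'g" where e: "circle_subgroup e" using circle_subgroup_exists[OF \<psi> comp] .
  have eadd: "\<And>s t. e (s + t) = e s + e t" and econt: "continuous_on UNIV e"
    and ker: "\<And>s. e s = 0 \<longleftrightarrow> s \<in> \<int>"
    using e by (auto simp: circle_subgroup_def)
  have ez: "zmul m (e s) = e (of_int m * s)" for m s
    using zmul_additive[of e m s] eadd by (simp add: zmul_real)
  have ediff: "e (s - t) = e s - e t" for s t using eadd[of "s - t" t] by simp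
  \<comment> \<open>the circle is compact, hence closed and preserved by limits of multiplications\<close>
  have "range e = e ` {0..1}"
  proof -
    have "e s = e (frac s)" for s
      using ediff[of s "of_int \<lfloor>s\<rfloor>"] ker[of "of_int \<lfloor>s\<rfloor>"] by (simp add: frac_def)
    moreover have "frac s \<in> {0..1}" for s :: real
      using frac_ge_0[of s] frac_lt_1[of s] by simp
    ultimately show ?thesis by blast
  qed
  moreover have "compact (e ` {0..1})"
    by (intro compact_continuous_image continuous_on_subset[OF econt]) auto
  ultimately have clo: "closed (range e)" by (simp add: compact_imp_closed)
  have range: "\<theta> 1 (e s) \<in> range e" for s
    by (rule Lim_in_closed_set[OF clo _ F lim1]) (simp add: ez)
  obtain c :: int where c: "\<And>n::nat. n \<ge> 1 \<Longrightarrow> \<theta> 1 (e (1 / real n)) = zmul c (e (1 / real n))"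
  proof (rule circle_endomorphism[OF e, of "\<lambda>s. \<theta> 1 (e s)"])
    show "\<theta> 1 (e (s + t)) = \<theta> 1 (e s) + \<theta> 1 (e t)" for s t by (simp only: eadd add)
    show "continuous_on UNIV (\<lambda>s. \<theta> 1 (e s))"
      by (rule continuous_on_compose2[OF cont[OF I] econt]) simp
    show "\<theta> 1 (e 1) = 0" using ker[of 1] add[of 0 0] by simp
  qed (use range in auto)
  \<comment> \<open>on the finite group of points of the circle whose order divides \<open>n\<close>, convergence means eventual equality\<close>
  have cong: "eventually (\<lambda>m. int n dvd m - c) F" if n: "n \<ge> 1" for n :: nat
  proof -
    have fin: "zmul m (e (1 / real n)) \<in> (\<lambda>j. e (of_int j / real n)) ` {0..<int n}" for m :: int
    proof -
      have "e (of_int m / real n) - e (of_int (m mod int n) / real n) = e (of_int (m div int n))"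
      proof -
        have "real_of_int m = of_int (m div int n) * real n + of_int (m mod int n)"
          by (metis div_mult_mod_eq of_int_add of_int_mult of_int_of_nat_eq)
        then have "of_int m / real n - of_int (m mod int n) / real n = of_int (m div int n)"
          using n by (simp add: field_simps)
        then show ?thesis by (simp flip: ediff)
      qed
      also have "\<dots> = 0" using ker by simp
      finally have "zmul m (e (1 / real n)) = e (of_int (m mod int n) / real n)" by (simp add: ez)
      then show ?thesis using n by auto
    qed
    have "eventually (\<lambda>m. zmul m (e (1 / real n)) = zmul c (e (1 / real n))) F"
      using eventually_eq_finite_range[OF lim1 _ fin] c[OF n] by simp
    then show ?thesis
    proof eventually_elim
      fix m assume "zmul m (e (1 / real n)) = zmul c (e (1 / real n))"
      then have "e (of_int (m - c) / real n) = 0" by (simp add: ez ediff diff_divide_distrib)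
      then obtain i :: int where "of_int (m - c) / real n = of_int i" using ker Ints_cases by metis
      then have "real_of_int (m - c) = of_int (i * int n)" using n by (simp add: field_simps)
      then have "m - c = i * int n" by linarith
      then show "int n dvd m - c" by simp
    qed
  qed
  have tors: "\<theta> i t = zmul (c ^ i) t" if i: "i \<in> I" and n: "n \<ge> 1" "zmul (int n) t = 0" for i n t
  proof -
    have "eventually (\<lambda>m. zmul (m ^ i) t = zmul (c ^ i) t) F"
      using cong[OF n(1)]
    proof eventually_elim
      fix m assume "int n dvd m - c"
      then have "int n dvd m ^ i - c ^ i"
        by (metis mod_eq_dvd_iff power_mod)
      then obtain q where "m ^ i - c ^ i = q * int n" by (metis dvd_def mult.commute)
      then have "zmul (m ^ i - c ^ i) t = zmul q (zmul (int n) t)" by (simp add: zmul_zmul)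
      then show "zmul (m ^ i) t = zmul (c ^ i) t" using n by (simp add: zmul_diff)
    qed
    then have "((\<lambda>m. zmul (m ^ i) t) \<longlongrightarrow> zmul (c ^ i) t) F" by (rule tendsto_eventually)
    then show ?thesis using tendsto_unique[OF F lim[OF i]] by blast
  qed
  have "\<theta> i = zmul (c ^ i)" if i: "i \<in> I" for i
  proof
    fix x
    let ?D = "{t. \<theta> i t \<noteq> zmul (c ^ i) t}"
    have "open ?D"
      by (intro open_Collect_neq cont[OF i] continuous_on_zmul continuous_on_id)
    then show "\<theta> i x = zmul (c ^ i) x"
      using torsion_dense[OF \<psi> comp, of ?D x] tors[OF i] by blast
  qed
  then show ?thesis using that by blast
qed

section \<open>Iterates of the skew product\<close>

text \<open>
  The rewrite rules about index sets \<open>{1..k}\<close> do not match the form \<open>{Suc 0..k}\<close>.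
\<close>

declare One_nat_def [simp del]

text \<open>
  The closed form of the powers of $T$: the sum runs from $j = 0$ with $x_0 = \gamma$, which absorbs the
  translation part of $T$ into a matrix.
\<close>

definition milnes_power :: "nat \<Rightarrow> 'g::ab_group_add \<Rightarrow> int \<Rightarrow> (nat \<Rightarrow> 'g) \<Rightarrow> (nat \<Rightarrow> 'g)" where
  "milnes_power k \<gamma> m x =
     (\<lambda>i\<in>{1..k}. \<Sum>j=0..i. zmul (m ^ (i - j) * int ((k - j) choose (i - j))) ((x(0 := \<gamma>)) j))"

lemma topspace_milnes_space [simp]: "topspace (milnes_space k) = extensional {1..k}"
  by (simp add: milnes_space_def PiE_UNIV_domain PiE_def)

lemma milnes_power_extensional [simp]: "milnes_power k \<gamma> m x \<in> extensional {1..k}"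
  by (simp add: milnes_power_def)

lemma sum_from_0_fun_upd:
  "(\<Sum>j=0..i. f j ((x(0 := \<gamma>)) j)) = f 0 \<gamma> + (\<Sum>j=1..i. f j (x j))" for i :: nat
  by (simp add: sum.atLeast_Suc_atMost One_nat_def)

lemma milnes_power_1: "milnes_power k \<gamma> 1 = milnes_map k \<gamma>"
proof
  fix x
  show "milnes_power k \<gamma> 1 x = milnes_map k \<gamma> x"
    unfolding milnes_power_def milnes_map_def
    by (intro restrict_ext, subst sum_from_0_fun_upd[where f = "\<lambda>j. zmul (1 ^ (_ - j) * int ((k - j) choose (_ - j)))"]) simp
qed

lemma milnes_power_0: "x \<in> extensional {1..k} \<Longrightarrow> milnes_power k \<gamma> 0 x = x"
proof (rule extensionalityI[of _ "{1..k}"])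
  fix i assume i: "i \<in> {1..k}"
  have "(\<Sum>j=0..i. zmul (0 ^ (i - j) * int ((k - j) choose (i - j))) ((x(0 := \<gamma>)) j)) =
        (\<Sum>j\<in>{i}. zmul (0 ^ (i - j) * int ((k - j) choose (i - j))) ((x(0 := \<gamma>)) j))"
    by (rule sum.mono_neutral_right) (auto simp: power_0_left)
  then show "milnes_power k \<gamma> 0 x i = x i" using i by (simp add: milnes_power_def)
qed auto

text \<open>
  The entries of the product of the matrices of $T^m$ and $T^n$. By
  $\binom{k-l}{j-l}\binom{k-j}{i-j} = \binom{k-l}{i-l}\binom{i-l}{j-l}$ this is the binomial theorem.
\<close>

lemma binomial_convolution:
  fixes m n :: int
  assumes "l \<le> i" "i \<le> k"
  shows "(\<Sum>j=l..i. m ^ (i - j) * int ((k - j) choose (i - j)) * (n ^ (j - l) * int ((k - l) choose (j - l)))) =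
         (m + n) ^ (i - l) * int ((k - l) choose (i - l))"
proof -
  have "(\<Sum>j=l..i. m ^ (i - j) * int ((k - j) choose (i - j)) * (n ^ (j - l) * int ((k - l) choose (j - l)))) =
      (\<Sum>s\<le>i - l. m ^ (i - l - s) * int ((k - l - s) choose (i - l - s)) * (n ^ s * int ((k - l) choose s)))"
    by (rule sum.reindex_bij_witness[of _ "\<lambda>s. s + l" "\<lambda>j. j - l"]) (use assms in auto)
  also have "\<dots> = (\<Sum>s\<le>i - l. int ((k - l) choose (i - l)) * (int ((i - l) choose s) * n ^ s * m ^ (i - l - s)))"
  proof (rule sum.cong)
    fix s assume "s \<in> {..i - l}"
    then have "((k - l) choose (i - l)) * ((i - l) choose s) = ((k - l) choose s) * ((k - l - s) choose (i - l - s))"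
      using assms by (intro choose_mult) auto
    then have "int ((k - l) choose (i - l)) * int ((i - l) choose s) = int ((k - l) choose s) * int ((k - l - s) choose (i - l - s))"
      by (metis of_nat_mult)
    then show "m ^ (i - l - s) * int ((k - l - s) choose (i - l - s)) * (n ^ s * int ((k - l) choose s)) =
        int ((k - l) choose (i - l)) * (int ((i - l) choose s) * n ^ s * m ^ (i - l - s))"
      by (simp add: mult_ac)
  qed simp
  also have "\<dots> = (m + n) ^ (i - l) * int ((k - l) choose (i - l))"
    by (simp add: sum_distrib_left[symmetric] binomial_ring[of n m] add.commute[of m n] mult.commute)
  finally show ?thesis .
qed

lemma milnes_power_add: "milnes_power k \<gamma> m (milnes_power k \<gamma> n x) = milnes_power k \<gamma> (m + n) x"
proof (rule extensionalityI[of _ "{1..k}"])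
  fix i assume i: "i \<in> {1..k}"
  let ?c = "\<lambda>m i j. m ^ (i - j) * int ((k - j) choose (i - j))"
  let ?x = "x(0 := \<gamma>)"
  have y: "((milnes_power k \<gamma> n x)(0 := \<gamma>)) j = (\<Sum>l | l \<in> {0..i} \<and> l \<le> j. zmul (?c n j l) (?x l))"
    if "j \<le> i" for j
  proof -
    have "{l. l \<in> {0..i} \<and> l \<le> j} = {0..j}" using that by auto
    then show ?thesis using that i by (cases "j = 0") (auto simp: milnes_power_def)
  qed
  have "milnes_power k \<gamma> m (milnes_power k \<gamma> n x) i =
      (\<Sum>j=0..i. zmul (?c m i j) (((milnes_power k \<gamma> n x)(0 := \<gamma>)) j))"
    using i by (simp only: milnes_power_def[of k \<gamma> m] restrict_apply')
  also have "\<dots> = (\<Sum>j=0..i. \<Sum>l | l \<in> {0..i} \<and> l \<le> j. zmul (?c m i j * ?c n j l) (?x l))"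
  proof (rule sum.cong[OF refl])
    fix j assume "j \<in> {0..i}"
    then have j: "j \<le> i" by simp
    show "zmul (?c m i j) (((milnes_power k \<gamma> n x)(0 := \<gamma>)) j) =
        (\<Sum>l | l \<in> {0..i} \<and> l \<le> j. zmul (?c m i j * ?c n j l) (?x l))"
      by (simp only: y[OF j] zmul_sum_right zmul_zmul)
  qed
  also have "\<dots> = (\<Sum>l=0..i. \<Sum>j | j \<in> {0..i} \<and> l \<le> j. zmul (?c m i j * ?c n j l) (?x l))"
    by (rule sum.swap_restrict) auto
  also have "\<dots> = (\<Sum>l=0..i. zmul (?c (m + n) i l) (?x l))"
  proof (rule sum.cong)
    fix l assume l: "l \<in> {0..i}"
    have "{j. j \<in> {0..i} \<and> l \<le> j} = {l..i}" using l by auto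
    then have "(\<Sum>j | j \<in> {0..i} \<and> l \<le> j. zmul (?c m i j * ?c n j l) (?x l)) =
        zmul (\<Sum>j=l..i. ?c m i j * ?c n j l) (?x l)" by (simp add: zmul_sum_left)
    then show "(\<Sum>j | j \<in> {0..i} \<and> l \<le> j. zmul (?c m i j * ?c n j l) (?x l)) = zmul (?c (m + n) i l) (?x l)"
      using binomial_convolution[of l i k m n] l i by simp
  qed simp
  also have "\<dots> = milnes_power k \<gamma> (m + n) x i" using i by (simp add: milnes_power_def)
  finally show "milnes_power k \<gamma> m (milnes_power k \<gamma> n x) i = milnes_power k \<gamma> (m + n) x i" .
qed auto

lemma int_iterate_milnes_map:
  "int_iterate (milnes_space k) (milnes_map k \<gamma>) m = restrict (milnes_power k \<gamma> m) (extensional {1..k})"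
proof -
  let ?X = "extensional {1..k} :: (nat \<Rightarrow> 'a) set"
  have inj: "inj_on (milnes_power k \<gamma> 1) ?X"
    by (rule inj_on_inverseI[of _ "milnes_power k \<gamma> (- 1)"]) (simp add: milnes_power_add milnes_power_0)
  have inv: "inv_into ?X (milnes_power k \<gamma> 1) x = milnes_power k \<gamma> (- 1) x" if "x \<in> ?X" for x
    by (rule inv_into_f_eq[OF inj]) (simp_all add: milnes_power_add milnes_power_0 that)
  have fwd: "(milnes_power k \<gamma> 1 ^^ n) x = milnes_power k \<gamma> (int n) x" if "x \<in> ?X" for n x
    by (induction n) (simp_all add: milnes_power_0 that milnes_power_add add.commute)
  have bwd: "(inv_into ?X (milnes_power k \<gamma> 1) ^^ n) x = milnes_power k \<gamma> (- int n) x" if "x \<in> ?X" for n x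
    by (induction n) (simp_all add: milnes_power_0 that inv milnes_power_add)
  show ?thesis
    unfolding int_iterate_def milnes_power_1[symmetric] topspace_milnes_space
    by (rule restrict_ext) (auto simp: fwd bwd)
qed

section \<open>The Ellis group and its coordinates\<close>

lemma limitin_milnes_space:
  "limitin (milnes_space k) f l F \<longleftrightarrow> l \<in> extensional {1..k} \<and>
     eventually (\<lambda>a. f a \<in> extensional {1..k}) F \<and> (\<forall>i\<in>{1..k}. ((\<lambda>a. f a i) \<longlongrightarrow> l i) F)"
  unfolding milnes_space_def limitin_componentwise topspace_milnes_space[unfolded milnes_space_def] by simp

lemma limitin_milnes:
  "limitin (self_maps (milnes_space k)) (int_iterate (milnes_space k) (milnes_map k \<gamma>)) \<tau> F \<longleftrightarrow>
     \<tau> \<in> topspace (self_maps (milnes_space k)) \<and>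
     (\<forall>x\<in>extensional {1..k}. \<forall>i\<in>{1..k}. ((\<lambda>m. milnes_power k \<gamma> m x i) \<longlongrightarrow> \<tau> x i) F)"
  unfolding self_maps_def int_iterate_milnes_map limitin_componentwise
  by (auto simp: limitin_milnes_space PiE_iff)

text \<open>
  A point of the closure is the limit of $f$ along the preimage of its neighbourhood filter.
\<close>

lemma closure_of_filter:
  assumes "y \<in> Y closure_of range f"
  obtains F where "F \<noteq> bot" "limitin Y f y F"
proof -
  let ?F = "filtercomap f (nhdsin Y y)"
  have y: "y \<in> topspace Y" "\<And>U. openin Y U \<Longrightarrow> y \<in> U \<Longrightarrow> \<exists>x. f x \<in> U"
    using assms by (auto simp: in_closure_of)
  have "?F \<noteq> bot"
    by (rule filtercomap_neq_bot) (use y in \<open>auto simp: eventually_nhdsin; blast\<close>)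
  moreover have "limitin Y f y ?F"
    unfolding limitin_def
  proof (intro conjI allI impI)
    fix U assume "openin Y U \<and> y \<in> U"
    then have "eventually (\<lambda>z. z \<in> U) (nhdsin Y y)" by (auto simp: eventually_nhdsin)
    then show "eventually (\<lambda>x. f x \<in> U) ?F" by (rule eventually_filtercomapI)
  qed (rule y)
  ultimately show ?thesis using that by blast
qed

lemma milnes_ellis_subset: "milnes_ellis k \<gamma> \<subseteq> topspace (self_maps (milnes_space k))"
  by (simp add: milnes_ellis_def ellis_group_def closure_of_subset_topspace)

lemma milnes_ellis_value: "\<tau> \<in> milnes_ellis k \<gamma> \<Longrightarrow> x \<in> extensional {1..k} \<Longrightarrow> \<tau> x \<in> extensional {1..k}"
  using milnes_ellis_subset[of k \<gamma>] by (auto simp: self_maps_def)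

lemma milnes_ellis_filter:
  assumes "\<tau> \<in> milnes_ellis k \<gamma>"
  obtains F where "F \<noteq> bot"
    "limitin (self_maps (milnes_space k)) (int_iterate (milnes_space k) (milnes_map k \<gamma>)) \<tau> F"
  using closure_of_filter assms unfolding milnes_ellis_def ellis_group_def by metis

text \<open>
  The point whose only nonzero entry is $t$, in position $k - i$. The coefficient of this entry in the
  last coordinate of $T^m$ is $m^i$, with binomial factor 1.
\<close>

definition milnes_point :: "nat \<Rightarrow> nat \<Rightarrow> 'g::zero \<Rightarrow> nat \<Rightarrow> 'g" where
  "milnes_point k i t = (\<lambda>j\<in>{1..k}. if j = k - i then t else 0)"

text \<open>
  The value of $\Theta$, read off from the last coordinate of \<open>\<tau>\<close>.
\<close>

definition milnes_coords :: "nat \<Rightarrow> ((nat \<Rightarrow> 'g) \<Rightarrow> (nat \<Rightarrow> 'g::ab_group_add)) \<Rightarrow> (nat \<Rightarrow> 'g \<Rightarrow> 'g) \<times> 'g" where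
  "milnes_coords k \<tau> =
     (\<lambda>i\<in>{1..<k}. \<lambda>t. \<tau> (milnes_point k i t) k - \<tau> (\<lambda>j\<in>{1..k}. 0) k, \<tau> (\<lambda>j\<in>{1..k}. 0) k)"

lemma milnes_power_apply:
  assumes "i \<in> {1..k}"
  shows "milnes_power k \<gamma> m x i = milnes_power k \<gamma> m (\<lambda>j\<in>{1..k}. 0) i +
    (\<Sum>j=1..<i. zmul (int ((k - j) choose (i - j))) (zmul (m ^ (i - j)) (x j))) + x i"
proof -
  let ?c = "\<lambda>j. m ^ (i - j) * int ((k - j) choose (i - j))"
  have eq: "milnes_power k \<gamma> m x i = zmul (?c 0) \<gamma> + (\<Sum>j=1..i. zmul (?c j) (x j))" for x
    using assms sum_from_0_fun_upd[of "\<lambda>j. zmul (?c j)" x \<gamma> i] by (simp add: milnes_power_def)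
  have "(\<Sum>j=1..i. zmul (?c j) (x j)) = (\<Sum>j=1..<i. zmul (?c j) (x j)) + x i"
  proof -
    have "{1..i} = insert i {1..<i}" using assms by auto
    then show ?thesis by (simp add: add.commute)
  qed
  moreover have "(\<Sum>j=1..i. zmul (?c j) ((\<lambda>j\<in>{1..k}. 0) j)) = 0"
    using assms by (intro sum.neutral) auto
  ultimately show ?thesis by (simp add: eq[of x] eq[of "\<lambda>j\<in>{1..k}. 0"] zmul_zmul mult.commute add.assoc)
qed

lemma milnes_limit_coords:
  fixes \<gamma> :: "'g::topological_ab_group_add"
  assumes k: "k \<ge> 1"
    and lim: "limitin (self_maps (milnes_space k)) (int_iterate (milnes_space k) (milnes_map k \<gamma>)) \<tau> F"
  shows "i \<in> {1..<k} \<Longrightarrow> ((\<lambda>m. zmul (m ^ i) t) \<longlongrightarrow> fst (milnes_coords k \<tau>) i t) F"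
    and "((\<lambda>m. zmul (m ^ k) \<gamma>) \<longlongrightarrow> snd (milnes_coords k \<tau>)) F"
proof -
  let ?z = "\<lambda>j\<in>{1..k}. 0"
  have L: "((\<lambda>m. milnes_power k \<gamma> m x k) \<longlongrightarrow> \<tau> x k) F" if "x \<in> extensional {1..k}" for x
    using lim that k by (auto simp: limitin_milnes)
  have zero: "milnes_power k \<gamma> m ?z k = zmul (m ^ k) \<gamma>" for m
  proof -
    have "(\<Sum>j=1..k. zmul (m ^ (k - j) * int ((k - j) choose (k - j))) (?z j)) = (0 :: 'g)"
      by (intro sum.neutral) auto
    then show ?thesis
      using k sum_from_0_fun_upd[of "\<lambda>j. zmul (m ^ (k - j) * int ((k - j) choose (k - j)))" ?z \<gamma> k]
      by (simp add: milnes_power_def)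
  qed
  show "((\<lambda>m. zmul (m ^ k) \<gamma>) \<longlongrightarrow> snd (milnes_coords k \<tau>)) F"
    using L[of ?z] by (simp add: zero milnes_coords_def)
  assume i: "i \<in> {1..<k}"
  have "milnes_power k \<gamma> m (milnes_point k i t) k - milnes_power k \<gamma> m ?z k = zmul (m ^ i) t" for m
  proof -
    have "(\<Sum>j=1..<k. zmul (int ((k - j) choose (k - j))) (zmul (m ^ (k - j)) (milnes_point k i t j))) =
        (\<Sum>j\<in>{k - i}. zmul (int ((k - j) choose (k - j))) (zmul (m ^ (k - j)) (milnes_point k i t j)))"
      using i by (intro sum.mono_neutral_right) (auto simp: milnes_point_def)
    also have "\<dots> = zmul (m ^ i) t" using i by (auto simp: milnes_point_def)
    finally show ?thesis
      using i by (subst milnes_power_apply) (auto simp: milnes_point_def)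
  qed
  moreover have "((\<lambda>m. milnes_power k \<gamma> m (milnes_point k i t) k - milnes_power k \<gamma> m ?z k)
      \<longlongrightarrow> \<tau> (milnes_point k i t) k - \<tau> ?z k) F"
    by (intro tendsto_diff L) (auto simp: milnes_point_def)
  ultimately show "((\<lambda>m. zmul (m ^ i) t) \<longlongrightarrow> fst (milnes_coords k \<tau>) i t) F"
    using i by (simp add: milnes_coords_def)
qed

text \<open>
  The limits in the definition of $\Theta$ exist along every net with $T^m \rightarrow \tau$, because they are
  differences of values of \<open>\<tau>\<close>; they are unique because the group is Hausdorff.
\<close>

lemma milnes_Theta_eq_coords:
  fixes \<gamma> :: "'g::{topological_ab_group_add,t2_space}"
  assumes k: "k \<ge> 1" and \<tau>: "\<tau> \<in> milnes_ellis k \<gamma>"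
  shows "milnes_Theta k \<gamma> \<tau> = milnes_coords k \<tau>"
  unfolding milnes_Theta_def
proof (rule the_equality)
  obtain F where "F \<noteq> bot"
    "limitin (self_maps (milnes_space k)) (int_iterate (milnes_space k) (milnes_map k \<gamma>)) \<tau> F"
    using milnes_ellis_filter[OF \<tau>] .
  moreover have "fst (milnes_coords k \<tau>) \<in> extensional {1..<k}" by (simp add: milnes_coords_def)
  ultimately show "milnes_limit k \<gamma> \<tau> (milnes_coords k \<tau>)"
    unfolding milnes_limit_def split_beta using milnes_limit_coords[OF k] by blast
next
  fix p assume "milnes_limit k \<gamma> \<tau> p"
  then obtain F where ext: "fst p \<in> extensional {1..<k}" and F: "F \<noteq> bot"
    and lim: "limitin (self_maps (milnes_space k)) (int_iterate (milnes_space k) (milnes_map k \<gamma>)) \<tau> F"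
    and p: "\<And>i t. i \<in> {1..<k} \<Longrightarrow> ((\<lambda>m. zmul (m ^ i) t) \<longlongrightarrow> fst p i t) F"
      "((\<lambda>m. zmul (m ^ k) \<gamma>) \<longlongrightarrow> snd p) F"
    unfolding milnes_limit_def split_beta by blast
  have "fst p = fst (milnes_coords k \<tau>)"
  proof (rule extensionalityI[OF ext])
    show "fst (milnes_coords k \<tau>) \<in> extensional {1..<k}" by (simp add: milnes_coords_def)
    fix i assume "i \<in> {1..<k}"
    then show "fst p i = fst (milnes_coords k \<tau>) i"
      using tendsto_unique[OF F p(1) milnes_limit_coords(1)[OF k lim]] by blast
  qed
  moreover have "snd p = snd (milnes_coords k \<tau>)"
    using tendsto_unique[OF F p(2) milnes_limit_coords(2)[OF k lim]] .
  ultimately show "p = milnes_coords k \<tau>" by (simp add: prod_eq_iff)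
qed

text \<open>
  The limit form of \<open>milnes_power_apply\<close>. The terms that do not involve $x$ are collected in the value
  at 0, so that the formula has the same shape for $i < k$ and for $i = k$.
\<close>

lemma milnes_ellis_apply:
  fixes \<gamma> :: "'g::{topological_ab_group_add,t2_space}"
  assumes k: "k \<ge> 1" and \<tau>: "\<tau> \<in> milnes_ellis k \<gamma>" and x: "x \<in> extensional {1..k}" and i: "i \<in> {1..k}"
  shows "\<tau> x i = \<tau> (\<lambda>j\<in>{1..k}. 0) i +
    (\<Sum>j=1..<i. zmul (int ((k - j) choose (i - j))) (fst (milnes_coords k \<tau>) (i - j) (x j))) + x i"
proof -
  obtain F where F: "F \<noteq> bot"
    "limitin (self_maps (milnes_space k)) (int_iterate (milnes_space k) (milnes_map k \<gamma>)) \<tau> F"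
    using milnes_ellis_filter[OF \<tau>] .
  have L: "((\<lambda>m. milnes_power k \<gamma> m y i) \<longlongrightarrow> \<tau> y i) F" if "y \<in> extensional {1..k}" for y
    using F(2) that i by (auto simp: limitin_milnes)
  have "((\<lambda>m. milnes_power k \<gamma> m x i) \<longlongrightarrow> \<tau> (\<lambda>j\<in>{1..k}. 0) i +
    (\<Sum>j=1..<i. zmul (int ((k - j) choose (i - j))) (fst (milnes_coords k \<tau>) (i - j) (x j))) + x i) F"
    unfolding milnes_power_apply[OF i, of \<gamma> _ x]
    by (intro tendsto_intros L milnes_limit_coords(1)[OF k F(2)]) (use i in auto)
  then show ?thesis using tendsto_unique[OF F(1) L[OF x]] by blast
qed

section \<open>Semigroup structure and compactness\<close>

lemma limitin_self_maps_milnes: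
  assumes "\<And>a. f a \<in> topspace (self_maps (milnes_space k))" "\<tau> \<in> topspace (self_maps (milnes_space k))"
    and "\<And>x i. x \<in> extensional {1..k} \<Longrightarrow> i \<in> {1..k} \<Longrightarrow> ((\<lambda>a. f a x i) \<longlongrightarrow> \<tau> x i) F"
  shows "limitin (self_maps (milnes_space k)) f \<tau> F"
  using assms unfolding self_maps_def limitin_componentwise
  by (auto simp: limitin_milnes_space PiE_iff)

lemma closedin_milnes_ellis: "closedin (self_maps (milnes_space k)) (milnes_ellis k \<gamma>)"
  by (simp add: milnes_ellis_def ellis_group_def)

lemma int_iterate_in_milnes_ellis:
  "int_iterate (milnes_space k) (milnes_map k \<gamma>) m \<in> milnes_ellis k \<gamma>"
proof -
  have "range (int_iterate (milnes_space k) (milnes_map k \<gamma>)) \<subseteq> topspace (self_maps (milnes_space k))"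
    by (auto simp: self_maps_def int_iterate_milnes_map)
  then show ?thesis
    unfolding milnes_ellis_def ellis_group_def using closure_of_subset by blast
qed

lemma compose_in_self_maps:
  "\<sigma> \<in> topspace (self_maps X) \<Longrightarrow> \<tau> \<in> topspace (self_maps X) \<Longrightarrow>
     compose (topspace X) \<sigma> \<tau> \<in> topspace (self_maps X)"
  by (auto simp: self_maps_def compose_def PiE_iff)

text \<open>
  Left composition with a power of $T$ preserves the Ellis group because it is continuous
  and permutes the powers of $T$; composition with a general \<open>\<sigma>\<close> follows since $T^m\tau \rightarrow \sigma\tau$
  pointwise along any net with $T^m \rightarrow \sigma$.
\<close>

lemma milnes_ellis_compose:
  fixes \<gamma> :: "'g::topological_ab_group_add"
  assumes \<sigma>: "\<sigma> \<in> milnes_ellis k \<gamma>" and \<tau>: "\<tau> \<in> milnes_ellis k \<gamma>"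
  shows "compose (topspace (milnes_space k)) \<sigma> \<tau> \<in> milnes_ellis k \<gamma>"
proof -
  let ?X = "milnes_space k :: (nat \<Rightarrow> 'g) topology" and ?S = "milnes_ellis k \<gamma>"
  let ?P = "int_iterate ?X (milnes_map k \<gamma>)"
  have mem: "\<rho> \<in> topspace (self_maps ?X)" if "\<rho> \<in> ?S" for \<rho> using milnes_ellis_subset that by blast
  have PS: "compose (topspace ?X) (?P m) \<tau> \<in> ?S" for m
  proof -
    obtain F where F: "F \<noteq> bot" "limitin (self_maps ?X) ?P \<tau> F" using milnes_ellis_filter[OF \<tau>] .
    have lim: "limitin (self_maps ?X) (\<lambda>n. ?P (m + n)) (compose (topspace ?X) (?P m) \<tau>) F"
    proof (rule limitin_self_maps_milnes)
      fix x :: "nat \<Rightarrow> 'g" and i assume x: "x \<in> extensional {1..k}" and i: "i \<in> {1..k}"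
      have "((\<lambda>n. ((milnes_power k \<gamma> n x)(0 := \<gamma>)) j) \<longlongrightarrow> ((\<tau> x)(0 := \<gamma>)) j) F" if "j \<le> k" for j
        using F(2) x that by (cases "j = 0") (auto simp: limitin_milnes)
      then have "((\<lambda>n. milnes_power k \<gamma> m (milnes_power k \<gamma> n x) i) \<longlongrightarrow> milnes_power k \<gamma> m (\<tau> x) i) F"
        using i unfolding milnes_power_def[of k \<gamma> m] restrict_apply'[OF i]
        by (intro tendsto_sum tendsto_zmul) auto
      then show "((\<lambda>n. ?P (m + n) x i) \<longlongrightarrow> compose (topspace ?X) (?P m) \<tau> x i) F"
        using x milnes_ellis_value[OF \<tau> x]
        by (simp add: milnes_power_add int_iterate_milnes_map compose_def)
    qed (intro compose_in_self_maps mem int_iterate_in_milnes_ellis \<tau>)+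
    show ?thesis
      by (rule limitin_closedin[OF lim closedin_milnes_ellis[of k \<gamma>]]) (auto simp: F(1) int_iterate_in_milnes_ellis)
  qed
  obtain F where F: "F \<noteq> bot" "limitin (self_maps ?X) ?P \<sigma> F" using milnes_ellis_filter[OF \<sigma>] .
  have lim: "limitin (self_maps ?X) (\<lambda>m. compose (topspace ?X) (?P m) \<tau>) (compose (topspace ?X) \<sigma> \<tau>) F"
  proof (rule limitin_self_maps_milnes)
    fix x :: "nat \<Rightarrow> 'g" and i assume x: "x \<in> extensional {1..k}" and i: "i \<in> {1..k}"
    then have "((\<lambda>m. milnes_power k \<gamma> m (\<tau> x) i) \<longlongrightarrow> \<sigma> (\<tau> x) i) F"
      using F(2) milnes_ellis_value[OF \<tau> x] by (auto simp: limitin_milnes)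
    then show "((\<lambda>m. compose (topspace ?X) (?P m) \<tau> x i) \<longlongrightarrow> compose (topspace ?X) \<sigma> \<tau> x i) F"
      using x milnes_ellis_value[OF \<tau> x] by (simp add: int_iterate_milnes_map compose_def)
  qed (intro compose_in_self_maps mem int_iterate_in_milnes_ellis \<sigma> \<tau>)+
  show ?thesis
    by (rule limitin_closedin[OF lim closedin_milnes_ellis[of k \<gamma>]]) (use F PS in auto)
qed

lemma compact_milnes_ellis:
  fixes \<gamma> :: "'g::topological_ab_group_add"
  assumes "compact (UNIV :: 'g set)"
  shows "compact_space (subtopology (self_maps (milnes_space k)) (milnes_ellis k \<gamma>))"
proof -
  have "compact_space (milnes_space k :: (nat \<Rightarrow> 'g) topology)"
    unfolding milnes_space_def compact_space_product_topology using assms by (simp add: compact_space_def)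
  then have "compact_space (self_maps (milnes_space k) :: ((nat \<Rightarrow> 'g) \<Rightarrow> (nat \<Rightarrow> 'g)) topology)"
    unfolding self_maps_def compact_space_product_topology by simp
  then show ?thesis
    using closedin_compact_space closedin_milnes_ellis compact_space_subtopology by blast
qed

lemma continuous_map_into_self_maps:
  fixes f :: "'y \<Rightarrow> (nat \<Rightarrow> 'g::topological_space) \<Rightarrow> nat \<Rightarrow> 'g"
  shows "continuous_map Y (self_maps (milnes_space k)) f \<longleftrightarrow>
     (\<forall>y\<in>topspace Y. f y \<in> topspace (self_maps (milnes_space k))) \<and>
     (\<forall>x\<in>extensional {1..k}. \<forall>i\<in>{1..k}. continuous_map Y euclidean (\<lambda>y. f y x i))"
proof -
  have "continuous_map Y (milnes_space k) g \<longleftrightarrow>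
      (\<forall>y\<in>topspace Y. g y \<in> extensional {1..k}) \<and> (\<forall>i\<in>{1..k}. continuous_map Y euclidean (\<lambda>y. g y i))"
    for g :: "'y \<Rightarrow> nat \<Rightarrow> 'g"
    unfolding milnes_space_def continuous_map_componentwise by (auto simp: image_subset_iff)
  then show ?thesis
    unfolding self_maps_def continuous_map_componentwise by (auto simp: image_subset_iff PiE_iff)
qed

lemma continuous_map_eval_milnes:
  assumes "x \<in> extensional {1..k}" "i \<in> {1..k}"
  shows "continuous_map (subtopology (self_maps (milnes_space k)) S) euclidean (\<lambda>\<tau>. \<tau> x i)"
proof -
  have "continuous_map (self_maps (milnes_space k)) (milnes_space k) (\<lambda>\<tau>. \<tau> x)"
    unfolding self_maps_def using assms by (intro continuous_map_product_projection) simp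
  moreover have "continuous_map (milnes_space k) euclidean (\<lambda>y. y i)"
    unfolding milnes_space_def using assms by (intro continuous_map_product_projection) simp
  ultimately have "continuous_map (self_maps (milnes_space k)) euclidean ((\<lambda>y. y i) \<circ> (\<lambda>\<tau>. \<tau> x))"
    by (rule continuous_map_compose)
  then show ?thesis by (simp add: o_def continuous_map_from_subtopology)
qed

section \<open>The topological centre\<close>

text \<open>
  Integer multiplications are continuous, so the coordinate formula exhibits $\sigma\tau$ evaluated at $x$
  as a continuous function of \<open>\<tau> x\<close>.
\<close>

lemma topological_centre_of_integral_coords:
  fixes \<gamma> :: "'g::{topological_ab_group_add,t2_space}"
  assumes k: "k \<ge> 1" and \<sigma>: "\<sigma> \<in> milnes_ellis k \<gamma>"
    and n: "\<And>i. i \<in> {1..<k} \<Longrightarrow> fst (milnes_coords k \<sigma>) i = zmul (n ^ i)"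
  shows "\<sigma> \<in> topological_centre (milnes_space k) (milnes_ellis k \<gamma>)"
proof -
  let ?X = "milnes_space k :: (nat \<Rightarrow> 'g) topology" and ?S = "milnes_ellis k \<gamma>"
  let ?Y = "subtopology (self_maps ?X) ?S"
  have topY: "topspace ?Y = ?S" using milnes_ellis_subset by (auto simp: topspace_subtopology)
  have ev: "((\<lambda>\<tau>. \<tau> x i) \<longlongrightarrow> \<tau>0 x i) (atin ?Y \<tau>0)"
    if "x \<in> extensional {1..k}" "i \<in> {1..k}" "\<tau>0 \<in> ?S" for x i \<tau>0
    using continuous_map_eval_milnes[OF that(1,2), of ?S] that(3) topY
    by (simp add: continuous_map_atin)
  have "continuous_map ?Y euclidean (\<lambda>\<tau>. compose (topspace ?X) \<sigma> \<tau> x i)"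
    if x: "x \<in> extensional {1..k}" and i: "i \<in> {1..k}" for x i
  proof (rule continuous_map_eq)
    let ?f = "\<lambda>\<tau>. \<sigma> (\<lambda>j\<in>{1..k}. 0) i +
      (\<Sum>j=1..<i. zmul (int ((k - j) choose (i - j))) (zmul (n ^ (i - j)) (\<tau> x j))) + \<tau> x i"
    show "continuous_map ?Y euclidean ?f"
      unfolding continuous_map_atin limitin_canonical_iff topY
      by (intro ballI tendsto_intros ev x) (use i in auto)
    fix \<tau> assume "\<tau> \<in> topspace ?Y"
    then have "\<tau> x \<in> extensional {1..k}" using topY milnes_ellis_value x by blast
    moreover have "fst (milnes_coords k \<sigma>) (i - j) = zmul (n ^ (i - j))" if "j \<in> {1..<i}" for j
      using that i by (intro n) auto
    ultimately have "\<sigma> (\<tau> x) i = ?f \<tau>"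
      by (subst milnes_ellis_apply[OF k \<sigma> _ i]) auto
    then show "?f \<tau> = compose (topspace ?X) \<sigma> \<tau> x i" using x by (simp add: compose_def)
  qed
  moreover have "compose (topspace ?X) \<sigma> \<tau> \<in> topspace (self_maps ?X)" if "\<tau> \<in> ?S" for \<tau>
    using milnes_ellis_compose[OF \<sigma> that] milnes_ellis_subset by blast
  ultimately have "continuous_map ?Y (self_maps ?X) (\<lambda>\<tau>. compose (topspace ?X) \<sigma> \<tau>)"
    using topY unfolding continuous_map_into_self_maps by auto
  then show ?thesis
    unfolding topological_centre_def using \<sigma> milnes_ellis_compose[OF \<sigma>] topY
    by (auto simp: continuous_map_in_subtopology)
qed

text \<open>
  In coordinate $i + 1$ of $\sigma(\tau(0))$ the map \<open>\<theta>\<^sub>i\<close> occurs only applied to $\tau(0)_1$; the other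
  terms are continuous in \<open>\<tau>\<close> by the induction hypothesis. Divisibility is used twice: the points
  $\tau(0)_1$ fill $kG = G$, and the binomial factor of \<open>\<theta>\<^sub>i\<close> can be cancelled.
\<close>

lemma centre_coords_continuous:
  fixes \<gamma> :: "'g::{topological_ab_group_add,t2_space}"
  assumes \<gamma>: "compact_monothetic \<gamma>" and div: "\<And>n::nat. n \<ge> 1 \<Longrightarrow> surj (zmul (int n) :: 'g \<Rightarrow> 'g)"
    and \<sigma>: "\<sigma> \<in> topological_centre (milnes_space k) (milnes_ellis k \<gamma>)"
    and i: "i \<in> {1..<k}"
  shows "continuous_on UNIV (fst (milnes_coords k \<sigma>) i)"
  using i
proof (induction i rule: less_induct)
  case (less i)
  let ?X = "milnes_space k :: (nat \<Rightarrow> 'g) topology" and ?S = "milnes_ellis k \<gamma>"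
  let ?Y = "subtopology (self_maps ?X) ?S"
  let ?z = "\<lambda>j\<in>{1..k}. (0::'g)"
  define \<theta> where "\<theta> = fst (milnes_coords k \<sigma>)"
  have comp: "compact (UNIV :: 'g set)" and dense: "closure (range (\<lambda>n. zmul n \<gamma>)) = UNIV"
    using \<gamma> by (auto simp: compact_monothetic_def)
  have k: "k \<ge> 1" and i: "i \<ge> 1" "i < k" using less.prems by auto
  have \<sigma>S: "\<sigma> \<in> ?S" using \<sigma> by (simp add: topological_centre_def)
  have topY: "topspace ?Y = ?S" using milnes_ellis_subset by (auto simp: topspace_subtopology)
  have cY: "compact_space ?Y" by (rule compact_milnes_ellis[OF comp])
  have ev: "continuous_map ?Y euclidean (\<lambda>\<tau>. \<tau> ?z j)" if "j \<in> {1..k}" for j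
    using that by (intro continuous_map_eval_milnes) auto
  have "continuous_map ?Y ?Y (\<lambda>\<tau>. compose (topspace ?X) \<sigma> \<tau>)"
    using \<sigma> by (simp add: topological_centre_def)
  from continuous_map_compose[OF this ev[of "Suc i"]]
  have c1: "continuous_map ?Y euclidean (\<lambda>\<tau>. \<sigma> (\<tau> ?z) (Suc i))"
    using i by (simp add: o_def compose_def)
  define C where "C = (k - 1) choose i"
  have C: "C \<ge> 1" using i zero_less_binomial[of i "k - 1"] unfolding C_def by linarith
  define R where "R \<tau> = (\<Sum>j=2..<Suc i. zmul (int ((k - j) choose (Suc i - j))) (\<theta> (Suc i - j) (\<tau> ?z j)))" for \<tau>
  have expand: "\<sigma> (\<tau> ?z) (Suc i) = \<sigma> ?z (Suc i) + (zmul (int C) (\<theta> i (\<tau> ?z 1)) + R \<tau>) + \<tau> ?z (Suc i)"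
    if "\<tau> \<in> ?S" for \<tau>
  proof -
    have "\<tau> ?z \<in> extensional {1..k}" using milnes_ellis_value[OF that] by simp
    moreover have "{1..<Suc i} = insert 1 {2..<Suc i}" using i by auto
    ultimately show ?thesis
      using i by (subst milnes_ellis_apply[OF k \<sigma>S]) (auto simp: \<theta>_def C_def R_def)
  qed
  have R: "continuous_map ?Y euclidean R"
    unfolding continuous_map_atin limitin_canonical_iff R_def
  proof (intro ballI tendsto_sum tendsto_zmul)
    fix \<tau>0 j assume \<tau>0: "\<tau>0 \<in> topspace ?Y" and j: "j \<in> {2..<Suc i}"
    have "continuous_on UNIV (\<theta> (Suc i - j))"
      unfolding \<theta>_def by (rule less.IH) (use j i in auto)
    then have "(\<theta> (Suc i - j) \<longlongrightarrow> \<theta> (Suc i - j) (\<tau>0 ?z j)) (nhds (\<tau>0 ?z j))"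
      by (metis UNIV_I continuous_on_def tendsto_at_iff_tendsto_nhds)
    moreover have "((\<lambda>\<tau>. \<tau> ?z j) \<longlongrightarrow> \<tau>0 ?z j) (atin ?Y \<tau>0)"
      using ev[of j] j i \<tau>0 by (simp add: continuous_map_atin)
    ultimately show "((\<lambda>\<tau>. \<theta> (Suc i - j) (\<tau> ?z j)) \<longlongrightarrow> \<theta> (Suc i - j) (\<tau>0 ?z j)) (atin ?Y \<tau>0)"
      by (rule filterlim_compose)
  qed
  have c2: "continuous_map ?Y euclidean (\<lambda>\<tau>. zmul (int C) (\<theta> i (\<tau> ?z 1)))"
  proof (rule continuous_map_eq)
    show "continuous_map ?Y euclidean (\<lambda>\<tau>. \<sigma> (\<tau> ?z) (Suc i) - \<tau> ?z (Suc i) - R \<tau> - \<sigma> ?z (Suc i))"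
      using c1 R ev[of "Suc i"] i unfolding continuous_map_atin limitin_canonical_iff
      by (auto intro!: tendsto_intros)
  qed (use expand topY in auto)
  \<comment> \<open>\<open>T ^ m\<close> takes 0 to a point with first coordinate \<open>k m \<gamma>\<close>; the image is compact, so it contains \<open>k G\<close>\<close>
  have surj1: "(\<lambda>\<tau>. \<tau> ?z 1) ` topspace ?Y = UNIV"
  proof -
    define Q where "Q = (\<lambda>\<tau>. \<tau> ?z 1) ` topspace ?Y"
    have "compactin euclidean ((\<lambda>\<tau>. \<tau> ?z 1) ` topspace ?Y)"
      using image_compactin[of ?Y "topspace ?Y", OF _ ev[of 1]] cY k by (simp add: compact_space_def)
    then have clo: "closed Q" by (simp add: Q_def compact_imp_closed)
    have "zmul (int k) (zmul m \<gamma>) \<in> Q" for m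
      unfolding Q_def
    proof
      show "int_iterate ?X (milnes_map k \<gamma>) m \<in> topspace ?Y"
        using topY int_iterate_in_milnes_ellis by blast
      show "zmul (int k) (zmul m \<gamma>) = int_iterate ?X (milnes_map k \<gamma>) m ?z 1"
        using k sum_from_0_fun_upd[of "\<lambda>j. zmul (m ^ (1 - j) * int ((k - j) choose (1 - j)))" ?z \<gamma> 1]
        by (simp add: int_iterate_milnes_map milnes_power_def zmul_zmul mult.commute choose_one)
    qed
    then have "range (\<lambda>m. zmul m \<gamma>) \<subseteq> zmul (int k) -` Q" by blast
    moreover have "closed (zmul (int k) -` Q)"
      by (intro closed_vimage clo continuous_on_zmul continuous_on_id)
    ultimately have "zmul (int k) -` Q = UNIV"
      using closure_minimal[of "range (\<lambda>m. zmul m \<gamma>)" "zmul (int k) -` Q"] unfolding dense by blast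
    then have "range (zmul (int k) :: 'g \<Rightarrow> 'g) \<subseteq> Q" by blast
    then have "Q = UNIV" using div[OF k] by auto
    then show ?thesis unfolding Q_def .
  qed
  have haus: "Hausdorff_space (euclidean :: 'g topology)"
    unfolding Hausdorff_space_def disjnt_def using hausdorff by fastforce
  have "quotient_map ?Y euclidean (\<lambda>\<tau>. \<tau> ?z 1)"
    using k by (intro continuous_imp_quotient_map ev cY) (use surj1 haus in auto)
  from continuous_compose_quotient_map[OF this, of euclidean "\<lambda>t. zmul (int C) (\<theta> i t)"]
  have c3: "continuous_map euclidean euclidean (\<lambda>t. zmul (int C) (\<theta> i t))" using c2 by (simp add: o_def)
  obtain F where F: "F \<noteq> bot" "limitin (self_maps ?X) (int_iterate ?X (milnes_map k \<gamma>)) \<sigma> F"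
    using milnes_ellis_filter[OF \<sigma>S] .
  have lim: "((\<lambda>m. zmul (m ^ i) t) \<longlongrightarrow> \<theta> i t) F" for t
    unfolding \<theta>_def by (rule milnes_limit_coords(1)[OF k F(2) less.prems])
  have hom: "\<theta> i (zmul (int C) t) = zmul (int C) (\<theta> i t)" for t
  proof -
    have "((\<lambda>m. zmul (m ^ i) (zmul (int C) t)) \<longlongrightarrow> zmul (int C) (\<theta> i t)) F"
      using tendsto_zmul[OF lim[of t], of "int C"] by (simp add: zmul_zmul mult.commute)
    then show ?thesis using tendsto_unique[OF F(1) lim] by blast
  qed
  have "quotient_map euclidean euclidean (zmul (int C) :: 'g \<Rightarrow> 'g)"
    using div[OF C] comp haus by (intro continuous_imp_quotient_map) (auto simp: compact_space_def intro: continuous_on_zmul continuous_on_id)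
  from continuous_compose_quotient_map[OF this, of euclidean "\<theta> i"]
  have "continuous_map euclidean euclidean (\<theta> i)" using c3 by (simp add: o_def hom)
  then show ?case by (simp add: \<theta>_def)
qed

text \<open>
  A connected discrete group is trivial, and then any $n$ will do; otherwise the group has
  additive coordinates.
\<close>

lemma centre_coords_integral:
  fixes \<gamma> :: "'g::{topological_ab_group_add,t2_space}"
  assumes k: "k \<ge> 2" and \<gamma>: "compact_monothetic \<gamma>" and conn: "connected (UNIV :: 'g set)"
    and lie: "lie_group TYPE('g) TYPE('e::euclidean_space)"
    and \<sigma>: "\<sigma> \<in> topological_centre (milnes_space k) (milnes_ellis k \<gamma>)"
  obtains n :: int where "\<And>i. i \<in> {1..<k} \<Longrightarrow> fst (milnes_coords k \<sigma>) i = zmul (n ^ i)"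
proof (cases "\<forall>x::'g. open {x}")
  case True
  then have "open {0::'g}" by blast
  then have "{0::'g} = UNIV" using conn unfolding connected_clopen by auto
  then have "x = y" for x y :: 'g by (metis UNIV_I singletonD)
  then show ?thesis using that[of 0] by blast
next
  case False
  obtain \<psi> :: "'e \<Rightarrow> 'g" where \<psi>: "additive_chart \<psi>" using lie_group_additive_chart[OF lie False] .
  have comp: "compact (UNIV :: 'g set)" using \<gamma> by (simp add: compact_monothetic_def)
  have "\<sigma> \<in> milnes_ellis k \<gamma>" using \<sigma> by (simp add: topological_centre_def)
  then obtain F where F: "F \<noteq> bot"
    "limitin (self_maps (milnes_space k)) (int_iterate (milnes_space k) (milnes_map k \<gamma>)) \<sigma> F"
    by (rule milnes_ellis_filter)
  obtain n :: int where "\<And>i. i \<in> {1..<k} \<Longrightarrow> fst (milnes_coords k \<sigma>) i = zmul (n ^ i)"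
  proof (rule continuous_limit_of_powers_integral[OF \<psi> comp F(1), of "{1..<k}" "fst (milnes_coords k \<sigma>)"])
    show "((\<lambda>m. zmul (m ^ i) t) \<longlongrightarrow> fst (milnes_coords k \<sigma>) i t) F" if "i \<in> {1..<k}" for i t
      using milnes_limit_coords(1)[OF _ F(2) that] k by simp
    show "continuous_on UNIV (fst (milnes_coords k \<sigma>) i)" if "i \<in> {1..<k}" for i
      using centre_coords_continuous[OF \<gamma> connected_group_divisible[OF \<psi> conn] \<sigma> that] .
  qed (use k in auto)
  then show ?thesis using that by blast
qed

theorem theorem6p1:
  fixes k :: nat and \<gamma>\<^sub>0 :: "'g::{topological_ab_group_add,t2_space}"
  assumes "k \<ge> 1" and "k \<noteq> 1"
    and "compact_monothetic \<gamma>\<^sub>0"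
    and "connected (UNIV :: 'g set)"
    and "lie_group TYPE('g) TYPE('e::euclidean_space)"
  shows "milnes_Theta k \<gamma>\<^sub>0 ` topological_centre (milnes_space k) (milnes_ellis k \<gamma>\<^sub>0) =
           {p \<in> milnes_Theta k \<gamma>\<^sub>0 ` milnes_ellis k \<gamma>\<^sub>0.
              \<exists>(n::int) (u::'g). p = (\<lambda>i\<in>{1..<k}. zmul (n ^ i), u)}
         \<and> milnes_Theta k \<gamma>\<^sub>0 ` topological_centre (milnes_space k) (milnes_ellis k \<gamma>\<^sub>0)
             \<subseteq> (\<Pi>\<^sub>E i\<in>{1..<k}. endos) \<times> UNIV"
proof -
  let ?\<Theta> = "milnes_Theta k \<gamma>\<^sub>0" and ?\<Sigma> = "milnes_ellis k \<gamma>\<^sub>0"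
  let ?\<Lambda> = "topological_centre (milnes_space k) ?\<Sigma>"
  let ?I = "\<lambda>p. \<exists>(n::int) (u::'g). p = (\<lambda>i\<in>{1..<k}. zmul (n ^ i), u)"
  have sub: "?\<Lambda> \<subseteq> ?\<Sigma>" by (auto simp: topological_centre_def)
  have \<Theta>: "?\<Theta> \<sigma> = milnes_coords k \<sigma>" if "\<sigma> \<in> ?\<Sigma>" for \<sigma>
    using milnes_Theta_eq_coords[OF assms(1) that] .
  have ext: "fst (milnes_coords k \<sigma>) \<in> extensional {1..<k}" for \<sigma> :: "(nat \<Rightarrow> 'g) \<Rightarrow> nat \<Rightarrow> 'g"
    by (simp add: milnes_coords_def)
  have integral: "?I (?\<Theta> \<sigma>)" if \<sigma>: "\<sigma> \<in> ?\<Lambda>" for \<sigma>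
  proof -
    obtain n :: int where n: "\<And>i. i \<in> {1..<k} \<Longrightarrow> fst (milnes_coords k \<sigma>) i = zmul (n ^ i)"
      using centre_coords_integral[OF _ assms(3-5) \<sigma>] assms(1,2) by auto
    have "fst (milnes_coords k \<sigma>) = (\<lambda>i\<in>{1..<k}. zmul (n ^ i))"
      by (rule extensionalityI[OF ext]) (auto simp: n)
    then have "?\<Theta> \<sigma> = (\<lambda>i\<in>{1..<k}. zmul (n ^ i), snd (milnes_coords k \<sigma>))"
      using \<Theta> sub \<sigma> by (metis prod.collapse subsetD)
    then show ?thesis by blast
  qed
  have central: "\<sigma> \<in> ?\<Lambda>" if \<sigma>: "\<sigma> \<in> ?\<Sigma>" and I: "?I (?\<Theta> \<sigma>)" for \<sigma>
  proof -
    obtain n :: int and u where "milnes_coords k \<sigma> = (\<lambda>i\<in>{1..<k}. zmul (n ^ i), u)"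
      using I unfolding \<Theta>[OF \<sigma>] by (elim exE)
    then show ?thesis
      by (intro topological_centre_of_integral_coords[OF assms(1) \<sigma>, of n]) simp
  qed
  have "?\<Theta> ` ?\<Lambda> = {p \<in> ?\<Theta> ` ?\<Sigma>. ?I p}"
  proof (intro equalityI subsetI CollectI conjI; (elim CollectE conjE)?)
    fix p assume "p \<in> ?\<Theta> ` ?\<Lambda>"
    then show "p \<in> ?\<Theta> ` ?\<Sigma>" "?I p" using sub integral by (fast, fast)
  next
    fix p assume "p \<in> ?\<Theta> ` ?\<Sigma>" "?I p"
    then show "p \<in> ?\<Theta> ` ?\<Lambda>" using central by fast
  qed
  moreover have "?\<Theta> ` ?\<Lambda> \<subseteq> (\<Pi>\<^sub>E i\<in>{1..<k}. endos) \<times> UNIV"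
  proof
    fix p assume "p \<in> ?\<Theta> ` ?\<Lambda>"
    then have "?I p" using integral by blast
    then show "p \<in> (\<Pi>\<^sub>E i\<in>{1..<k}. endos) \<times> UNIV"
      by (auto simp: endos_def zmul_add_right)
  qed
  ultimately show ?thesis by blast
qed

end
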